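(* Let $K$ be a field and let $I\subseteq K[x,y,z]=K[\mathbb{P}^2]$ be the homogeneous ideal of a finite set of points of $\mathbb{P}^2$. (a) If $I$ is the ideal of an almost collinear subscheme of $n+1$ points with $n\geq 3$, then $\rho(I)=\frac{n^2}{n^2-n+1}$. Moreover, for positive integers $m,r$, $I^{(m)}\not\subseteq I^r$ holds if and only if $m\leq \frac{n^2r-n}{n^2-n+1}$. (b) If $I$ is the ideal of a nearly-complete intersection of $2n+1$ points, then $\rho(I)=\frac{4}{3}$. Moreover, for positive integers $m,r$, $I^{(m)}\subseteq I^r$ if and only if $4r\leq 3m+1$.
   Context: $K$ is a field of arbitrary characteristic and $K[\mathbb{P}^2]=K[x,y,z]$. The ideal of a finite set of distinct points $q_1,\dots,q_s\in\mathbb{P}^2$ is $I=\bigcap_i I(q_i)$, where $I(q_i)$ is the ideal generated by all forms vanishing at $q_i$; its $m$-th symbolic power is $I^{(m)}=\bigcap_i I(q_i)^m$. The resurgence is $\rho(I)=\sup\{m/r : I^{(m)}\not\subseteq I^r\}$, over positive integers $m,r$. An almost collinear subscheme of $n+1$ points ($n\geq 2$) is a set of distinct points $p_0,p_1,\dots,p_n\in\mathbb{P}^2$ such that $p_1,\dots,p_n$ lie on a line $L$ and $p_0\notin L$. A nearly-complete intersection of $2n+1$ points ($n\geq 1$) is a set of distinct points $p_0,p_1,\dots,p_{2n}\in\mathbb{P}^2$ for which there are two distinct lines $L_1,L_2$ such that $p_0$ is the point $L_1\cap L_2$, $p_1,\dots,p_n\in L_1\setminus L_2$ and $p_{n+1},\dots,p_{2n}\in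 L_2\setminus L_1$. *)

theory Defs
  imports "HOL-Analysis.Analysis" "HOL-Library.Poly_Mapping"
begin

section \<open>The polynomial ring $K[x,y,z]$\<close>

text \<open>
  The three variables are indexed by the three-element type \<open>3\<close>, so a monomial is an exponent
  vector of type \<open>3 \<Rightarrow>\<^sub>0 nat\<close>; the ring multiplication of \<^theory>\<open>HOL-Library.Poly_Mapping\<close> is
  convolution over addition of exponent vectors.
\<close>

type_synonym 'a poly3 = "(3 \<Rightarrow>\<^sub>0 nat) \<Rightarrow>\<^sub>0 'a"

definition eval3 :: "'a::comm_ring_1 poly3 \<Rightarrow> 'a ^ 3 \<Rightarrow> 'a" where
  "eval3 f v = (\<Sum>t\<in>Poly_Mapping.keys f.
     Poly_Mapping.lookup f t * (\<Prod>i\<in>UNIV. (v $ i) ^ Poly_Mapping.lookup t i))"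

definition homogeneous :: "nat \<Rightarrow> 'a::zero poly3 \<Rightarrow> bool" where
  "homogeneous d f \<longleftrightarrow>
     (\<forall>t\<in>Poly_Mapping.keys f. (\<Sum>i\<in>UNIV. Poly_Mapping.lookup t i) = d)"

section \<open>Ideals\<close>

definition ideal_gen :: "'a::comm_ring_1 set \<Rightarrow> 'a set" where
  "ideal_gen = module.span (*)"

primrec ideal_power :: "'a::comm_ring_1 set \<Rightarrow> nat \<Rightarrow> 'a set" where
  "ideal_power J 0 = UNIV"
| "ideal_power J (Suc k) = ideal_gen {a * b | a b. a \<in> J \<and> b \<in> ideal_power J k}"

section \<open>The projective plane\<close>

definition proportional :: "'a::field ^ 3 \<Rightarrow> 'a ^ 3 \<Rightarrow> bool" where
  "proportional u v \<longleftrightarrow> u \<noteq> 0 \<and> v \<noteq> 0 \<and> (\<exists>c. c \<noteq> 0 \<and> v = c *s u)"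

lemma part_equivp_proportional: "part_equivp (proportional :: 'a::field ^ 3 \<Rightarrow> _)"
proof (rule part_equivpI)
  have "proportional (vec 1 :: 'a ^ 3) (vec 1)"
    unfolding proportional_def by (auto simp: vec_eq_iff intro!: exI[of _ 1])
  then show "\<exists>u :: 'a ^ 3. proportional u u" by blast
  show "symp (proportional :: 'a ^ 3 \<Rightarrow> _)"
  proof (rule sympI)
    fix u v :: "'a ^ 3"
    assume "proportional u v"
    then obtain c where c: "u \<noteq> 0" "v \<noteq> 0" "c \<noteq> 0" "v = c *s u"
      unfolding proportional_def by blast
    then have "u = inverse c *s v" by (simp add: vector_smult_assoc)
    with c show "proportional v u"
      unfolding proportional_def using nonzero_imp_inverse_nonzero by blast
  qed
  show "transp (proportional :: 'a ^ 3 \<Rightarrow> _)"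
  proof (rule transpI)
    fix u v w :: "'a ^ 3"
    assume uv: "proportional u v" and vw: "proportional v w"
    from uv obtain c where c: "u \<noteq> 0" "c \<noteq> 0" "v = c *s u"
      unfolding proportional_def by blast
    from vw obtain d where d: "w \<noteq> 0" "d \<noteq> 0" "w = d *s v"
      unfolding proportional_def by blast
    have "w = (d * c) *s u" "d * c \<noteq> 0"
      using c d by (auto simp: vector_smult_assoc)
    with c d show "proportional u w"
      unfolding proportional_def by blast
  qed
qed

quotient_type (overloaded) 'a proj_plane = "'a::field ^ 3" / partial: proportional
  by (rule part_equivp_proportional)

definition homogeneous_coords :: "'a::field proj_plane \<Rightarrow> ('a ^ 3) set" where
  "homogeneous_coords q = {v. v \<noteq> 0 \<and> abs_proj_plane v = q}"

definition vanishes_at :: "'a::field poly3 \<Rightarrow> 'a proj_plane \<Rightarrow> bool" where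
  "vanishes_at f q \<longleftrightarrow> (\<forall>v\<in>homogeneous_coords q. eval3 f v = 0)"

definition line :: "'a::field proj_plane set \<Rightarrow> bool" where
  "line L \<longleftrightarrow> (\<exists>l. homogeneous 1 l \<and> l \<noteq> 0 \<and> L = {q. vanishes_at l q})"

section \<open>Ideals of points, symbolic powers, resurgence\<close>

definition point_ideal :: "'a::field proj_plane \<Rightarrow> 'a poly3 set" where
  "point_ideal q = ideal_gen {f. (\<exists>d. homogeneous d f) \<and> vanishes_at f q}"

definition points_ideal :: "'a::field proj_plane set \<Rightarrow> 'a poly3 set" where
  "points_ideal Q = (\<Inter>q\<in>Q. point_ideal q)"

text \<open>The argument is the set of points \<open>Q\<close>, not the ideal \<open>points_ideal Q\<close>.\<close>

definition symbolic_power :: "'a::field proj_plane set \<Rightarrow> nat \<Rightarrow> 'a poly3 set" where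
  "symbolic_power Q m = (\<Inter>q\<in>Q. ideal_power (point_ideal q) m)"

text \<open>
  The supremum is taken in \<^typ>\<open>ereal\<close>, where it always exists; in \<^typ>\<open>real\<close> it would be
  unspecified for an empty or unbounded set.
\<close>

definition resurgence :: "'a::field proj_plane set \<Rightarrow> ereal" where
  "resurgence Q = Sup {ereal (real m / real r) | m r.
     m > 0 \<and> r > 0 \<and> \<not> symbolic_power Q m \<subseteq> ideal_power (points_ideal Q) r}"

section \<open>Point configurations\<close>

definition almost_collinear :: "nat \<Rightarrow> 'a::field proj_plane set \<Rightarrow> bool" where
  "almost_collinear n Q \<longleftrightarrow> n \<ge> 2 \<and>
     (\<exists>p L. Q = p ` {0..n} \<and> inj_on p {0..n} \<and> line L \<and>
        (\<forall>i\<in>{1..n}. p i \<in> L) \<and> p 0 \<notin> L)"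

definition nearly_complete_intersection :: "nat \<Rightarrow> 'a::field proj_plane set \<Rightarrow> bool" where
  "nearly_complete_intersection n Q \<longleftrightarrow> n \<ge> 1 \<and>
     (\<exists>p L1 L2. Q = p ` {0..2 * n} \<and> inj_on p {0..2 * n} \<and>
        line L1 \<and> line L2 \<and> L1 \<noteq> L2 \<and> L1 \<inter> L2 = {p 0} \<and>
        (\<forall>i\<in>{1..n}. p i \<in> L1 - L2) \<and> (\<forall>i\<in>{n + 1..2 * n}. p i \<in> L2 - L1))"

end

theory Submission
  imports Defs "HOL-Computational_Algebra.Polynomial_Factorial"
begin

text \<open>
  The idea is to choose linear coordinates in which all ideals involved are generated by monomials
  in the coordinates and one further form, so that containment becomes a question about exponents.

  For \<open>n\<close> points on the line \<open>z = 0\<close> and a point off it at \<open>x = y = 0\<close>, let \<open>F\<close> be the product of the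
  \<open>n\<close> linear forms in \<open>x, y\<close> that define the lines joining them. Then the symbolic power of exponent
  \<open>m\<close> is generated by the products \<open>z\<^sup>t F\<^sup>k x\<^sup>i y\<^sup>j\<close> with \<open>t + k \<ge> m\<close> and \<open>n k + i + j \<ge> m\<close>
  (\<open>almost_collinear_symbolic_power\<close>): the coefficient of \<open>z\<^sup>t\<close> is divisible by \<open>F\<close> to the power
  \<open>m - t\<close>, because the linear factors of \<open>F\<close> are pairwise coprime primes, and its order in \<open>x, y\<close> is at
  least \<open>m\<close>, while \<open>F\<close> has order exactly \<open>n\<close>. In particular \<open>I = (z x, z y, F)\<close>.

  For a nearly complete intersection on the lines \<open>x = 0\<close> and \<open>y = 0\<close> there is a form \<open>H\<close> of degree \<open>n\<close>,
  monic in \<open>z\<close>, such that the \<open>2 n\<close> points other than the common one are the complete intersection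
  \<open>x y = H = 0\<close>. The symbolic power is then generated by the products \<open>x\<^sup>i y\<^sup>j H\<^sup>k\<close> in which any two
  exponents sum to at least \<open>m\<close> (\<open>nearly_complete_intersection_symbolic_power\<close>); this uses the
  expansion of polynomials in powers of the monic \<open>H\<close>. In particular \<open>I = (x y, x H, y H)\<close>.

  A containment is proved generator by generator. A non-containment is proved by a homomorphism
  \<open>\<theta>\<close> to \<open>K[u][T]\<close> for which all of \<open>\<theta> I\<close> is divisible by a fixed power \<open>T\<^sup>w\<close>, where \<open>w = n\<close> in the
  first and \<open>w = 2 n\<close> in the second configuration: then \<open>\<theta> I\<^sup>r\<close> is divisible by the \<open>r\<close>-th power of
  this, but some generator of the symbolic power has an image of smaller order in \<open>T\<close>. Comparing
  exponents gives \<open>almost_collinear_containment_iff\<close> and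
  \<open>nearly_complete_intersection_containment_iff\<close>. Both say that containment fails exactly if
  \<open>N m + B \<le> A r\<close> for certain constants \<open>B \<le> A\<close>, and then the resurgence is \<open>A / N\<close>
  (\<open>resurgence_eqI\<close>).
\<close>

section \<open>Ideals of a commutative ring and their powers\<close>

lemma module_mult: "module ((*) :: 'a::comm_ring_1 \<Rightarrow> 'a \<Rightarrow> 'a)"
  by unfold_locales (simp_all add: algebra_simps)

lemma ideal_gen_base: "a \<in> S \<Longrightarrow> a \<in> ideal_gen S"
  unfolding ideal_gen_def by (rule module.span_base[OF module_mult])

lemma ideal_gen_0: "0 \<in> ideal_gen S"
  unfolding ideal_gen_def by (rule module.span_zero[OF module_mult])

lemma ideal_gen_add: "a \<in> ideal_gen S \<Longrightarrow> b \<in> ideal_gen S \<Longrightarrow> a + b \<in> ideal_gen S"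
  unfolding ideal_gen_def by (rule module.span_add[OF module_mult])

lemma ideal_gen_diff: "a \<in> ideal_gen S \<Longrightarrow> b \<in> ideal_gen S \<Longrightarrow> a - b \<in> ideal_gen S"
  unfolding ideal_gen_def by (rule module.span_diff[OF module_mult])

lemma ideal_gen_mult: "a \<in> ideal_gen S \<Longrightarrow> r * a \<in> ideal_gen S"
  unfolding ideal_gen_def by (rule module.span_scale[OF module_mult])

lemma ideal_gen_mult_right: "a \<in> ideal_gen S \<Longrightarrow> a * r \<in> ideal_gen S"
  using ideal_gen_mult[of a S r] by (simp add: mult.commute)

lemma ideal_gen_sum: "(\<And>i. i \<in> A \<Longrightarrow> f i \<in> ideal_gen S) \<Longrightarrow> sum f A \<in> ideal_gen S"
  unfolding ideal_gen_def by (rule module.span_sum[OF module_mult])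

lemma ideal_gen_least: "S \<subseteq> ideal_gen T \<Longrightarrow> ideal_gen S \<subseteq> ideal_gen T"
  unfolding ideal_gen_def
  by (rule module.span_minimal[OF module_mult _ module.subspace_span[OF module_mult]])

lemma ideal_gen_mono: "S \<subseteq> T \<Longrightarrow> ideal_gen S \<subseteq> ideal_gen T"
  by (rule ideal_gen_least) (blast intro: ideal_gen_base)

lemma ideal_gen_induct [consumes 1, case_names zero step]:
  assumes "a \<in> ideal_gen S" and "P 0"
    and "\<And>r s b. s \<in> S \<Longrightarrow> b \<in> ideal_gen S \<Longrightarrow> P b \<Longrightarrow> P (r * s + b)"
  shows "P a"
proof -
  have "P a \<and> a \<in> ideal_gen S"
  proof (rule module.span_induct_alt[OF module_mult assms(1)[unfolded ideal_gen_def]])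
    show "P 0 \<and> 0 \<in> ideal_gen S" using assms(2) ideal_gen_0 by simp
  next
    fix c x y assume "x \<in> S" "P y \<and> y \<in> ideal_gen S"
    then show "P (c * x + y) \<and> c * x + y \<in> ideal_gen S"
      by (simp add: assms(3) ideal_gen_add ideal_gen_mult ideal_gen_base)
  qed
  then show ?thesis ..
qed

lemma ideal_power_0_mem: "0 \<in> ideal_power J k"
  by (cases k) (auto intro: ideal_gen_0)

lemma ideal_power_add_mem:
  "a \<in> ideal_power J k \<Longrightarrow> b \<in> ideal_power J k \<Longrightarrow> a + b \<in> ideal_power J k"
  by (cases k) (auto intro: ideal_gen_add)

lemma ideal_power_scale_mem: "a \<in> ideal_power J k \<Longrightarrow> r * a \<in> ideal_power J k"
  by (cases k) (auto intro: ideal_gen_mult)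

lemma ideal_gen_subset_ideal_power:
  assumes "S \<subseteq> ideal_power J k"
  shows "ideal_gen S \<subseteq> ideal_power J k"
proof
  fix a assume "a \<in> ideal_gen S"
  then show "a \<in> ideal_power J k"
  proof (induction rule: ideal_gen_induct)
    case zero
    show ?case by (rule ideal_power_0_mem)
  next
    case (step r s b)
    with assms show ?case by (blast intro: ideal_power_add_mem ideal_power_scale_mem)
  qed
qed

lemma ideal_power_Suc_base:
  "x \<in> J \<Longrightarrow> y \<in> ideal_power J k \<Longrightarrow> x * y \<in> ideal_power J (Suc k)"
  unfolding ideal_power.simps by (rule ideal_gen_base) blast

lemma ideal_power_mult_mem:
  assumes "a \<in> ideal_power J i" "b \<in> ideal_power J j"
  shows "a * b \<in> ideal_power J (i + j)"
  using assms(1)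
proof (induction i arbitrary: a)
  case 0
  then show ?case using assms(2) by (simp add: ideal_power_scale_mem)
next
  case (Suc i)
  from Suc.prems have "a \<in> ideal_gen {x * y | x y. x \<in> J \<and> y \<in> ideal_power J i}" by simp
  then show ?case
  proof (induction rule: ideal_gen_induct)
    case zero
    then show ?case using ideal_power_0_mem[of J "Suc i + j"] by simp
  next
    case (step r s c)
    from step(1) obtain x y where xy: "s = x * y" "x \<in> J" "y \<in> ideal_power J i" by blast
    have "y * b \<in> ideal_power J (i + j)" using Suc.IH xy by blast
    then have "x * (y * b) \<in> ideal_power J (Suc i + j)"
      unfolding add_Suc by (rule ideal_power_Suc_base[OF xy(2)])
    then have "r * (x * (y * b)) + c * b \<in> ideal_power J (Suc i + j)"
      by (intro ideal_power_add_mem step) (rule ideal_power_scale_mem)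
    then show ?case unfolding xy by (simp only: distrib_right mult.assoc)
  qed
qed

lemma ideal_power_antimono: "j \<le> i \<Longrightarrow> ideal_power J i \<subseteq> ideal_power J j"
proof (induction rule: inc_induct)
  case (step k)
  have "ideal_power J (Suc k) \<subseteq> ideal_power J k"
    unfolding ideal_power.simps
    by (rule ideal_gen_subset_ideal_power) (auto intro: ideal_power_scale_mem)
  with step show ?case by blast
qed simp

lemma ideal_power_1_base: "a \<in> J \<Longrightarrow> a \<in> ideal_power J 1"
  using ideal_power_Suc_base[of a J 1 0] by simp

lemma ideal_power_1: "ideal_power (ideal_gen S) 1 = ideal_gen S"
proof
  show "ideal_power (ideal_gen S) 1 \<subseteq> ideal_gen S"
    unfolding One_nat_def ideal_power.simps
    by (rule ideal_gen_least) (auto intro: ideal_gen_mult_right)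
  show "ideal_gen S \<subseteq> ideal_power (ideal_gen S) 1"
    using ideal_power_1_base by blast
qed

lemma power_mem_ideal_power: "a \<in> ideal_power J i \<Longrightarrow> a ^ k \<in> ideal_power J (i * k)"
proof (induction k)
  case (Suc k)
  have "a * a ^ k \<in> ideal_power J (i + i * k)" by (intro ideal_power_mult_mem Suc)
  then show ?case by simp
qed simp

lemma power_mem_ideal_power': "a \<in> J \<Longrightarrow> a ^ k \<in> ideal_power J k"
  using power_mem_ideal_power[OF ideal_power_1_base, of a J k] by (simp only: mult_1)

lemma prod_mem_ideal_power:
  "finite A \<Longrightarrow> (\<And>i. i \<in> A \<Longrightarrow> f i \<in> J) \<Longrightarrow> prod f A \<in> ideal_power J (card A)"
proof (induction rule: finite_induct)
  case (insert i A)
  have "f i * prod f A \<in> ideal_power J (1 + card A)"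
    using insert by (intro ideal_power_mult_mem ideal_power_1_base) auto
  with insert show ?case by simp
qed simp

lemma pair_gen_base: "m \<le> i + j \<Longrightarrow> a ^ i * b ^ j \<in> ideal_gen {a ^ i * b ^ j | i j. m \<le> i + j}"
  by (rule ideal_gen_base) blast

text \<open>
  Monomials of degree at least \<open>m\<close>, rather than equal to \<open>m\<close>, generate the same ideal and are
  stable under multiplication.
\<close>

lemma ideal_power_pair:
  "ideal_power (ideal_gen {a, b}) m = ideal_gen {a ^ i * b ^ j | i j. m \<le> i + j}"
proof
  show "ideal_power (ideal_gen {a, b}) m \<subseteq> ideal_gen {a ^ i * b ^ j | i j. m \<le> i + j}"
  proof (induction m)
    case 0
    have "a ^ 0 * b ^ 0 \<in> ideal_gen {a ^ i * b ^ j | i j. 0 \<le> i + j}"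
      by (rule ideal_gen_base) blast
    then show ?case using ideal_gen_mult by fastforce
  next
    case (Suc m)
    let ?G = "\<lambda>m. ideal_gen {a ^ i * b ^ j | i j. m \<le> i + j}"
    have ab: "a * y \<in> ?G (Suc m) \<and> b * y \<in> ?G (Suc m)" if "y \<in> ?G m" for y
      using that
    proof (induction rule: ideal_gen_induct)
      case zero
      then show ?case by (simp add: ideal_gen_0)
    next
      case (step r s y)
      from step(1) obtain i j where s: "s = a ^ i * b ^ j" "m \<le> i + j" by blast
      have "a ^ Suc i * b ^ j \<in> ?G (Suc m)" "a ^ i * b ^ Suc j \<in> ?G (Suc m)"
        using s pair_gen_base[of "Suc m" "Suc i" j a b] pair_gen_base[of "Suc m" i "Suc j" a b]
        by (simp_all del: power_Suc)
      then have "r * (a ^ Suc i * b ^ j) + a * y \<in> ?G (Suc m)"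
          "r * (a ^ i * b ^ Suc j) + b * y \<in> ?G (Suc m)"
        using step by (simp_all only: ideal_gen_add ideal_gen_mult)
      then show ?case by (simp add: s algebra_simps)
    qed
    have "x * y \<in> ?G (Suc m)" if "x \<in> ideal_gen {a, b}" "y \<in> ?G m" for x y
      using that(1)
    proof (induction rule: ideal_gen_induct)
      case zero
      then show ?case by (simp add: ideal_gen_0)
    next
      case (step r s x)
      have "s * y \<in> ?G (Suc m)" using step(1) ab[OF that(2)] by auto
      then have "r * (s * y) + x * y \<in> ?G (Suc m)"
        using step by (simp only: ideal_gen_add ideal_gen_mult)
      then show ?case by (simp add: algebra_simps)
    qed
    then show ?case unfolding ideal_power.simps using Suc
      by (intro ideal_gen_least) blast
  qed
  show "ideal_gen {a ^ i * b ^ j | i j. m \<le> i + j} \<subseteq> ideal_power (ideal_gen {a, b}) m"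
  proof (rule ideal_gen_subset_ideal_power, safe)
    fix i j assume le: "m \<le> i + j"
    have "a ^ i * b ^ j \<in> ideal_power (ideal_gen {a, b}) (i + j)"
      by (intro ideal_power_mult_mem power_mem_ideal_power' ideal_gen_base) auto
    with le show "a ^ i * b ^ j \<in> ideal_power (ideal_gen {a, b}) m"
      using ideal_power_antimono by blast
  qed
qed

section \<open>Ring homomorphisms\<close>

text \<open>Homomorphisms of commutative rings that preserve the unit.\<close>

locale unital_hom =
  fixes \<phi> :: "'r::comm_ring_1 \<Rightarrow> 's::comm_ring_1"
  assumes hom_1 [simp]: "\<phi> 1 = 1"
    and hom_add [simp]: "\<phi> (a + b) = \<phi> a + \<phi> b"
    and hom_mult [simp]: "\<phi> (a * b) = \<phi> a * \<phi> b"
begin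

lemma hom_0 [simp]: "\<phi> 0 = 0"
proof -
  have "\<phi> 0 + \<phi> 0 = \<phi> 0 + 0" using hom_add[of 0 0] by simp
  then show ?thesis by (simp only: add_left_cancel)
qed

lemma hom_minus [simp]: "\<phi> (- a) = - \<phi> a"
proof -
  have "\<phi> a + \<phi> (- a) = 0" by (simp only: hom_add[symmetric]) simp
  then show ?thesis by (rule minus_unique[symmetric])
qed

lemma hom_diff [simp]: "\<phi> (a - b) = \<phi> a - \<phi> b"
  using hom_add[of a "- b"] by simp

lemma hom_power [simp]: "\<phi> (a ^ n) = \<phi> a ^ n"
  by (induction n) auto

lemma hom_sum [simp]: "\<phi> (sum f A) = (\<Sum>i\<in>A. \<phi> (f i))"
  by (induction A rule: infinite_finite_induct) auto

lemma hom_prod [simp]: "\<phi> (prod f A) = (\<Prod>i\<in>A. \<phi> (f i))"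
  by (induction A rule: infinite_finite_induct) auto

lemma hom_ideal_gen: "a \<in> ideal_gen S \<Longrightarrow> \<phi> a \<in> ideal_gen (\<phi> ` S)"
  by (induction rule: ideal_gen_induct)
    (auto intro!: ideal_gen_0 ideal_gen_add ideal_gen_mult intro: ideal_gen_base)

lemma hom_pair_power:
  assumes "f \<in> ideal_gen {a ^ i * b ^ j | i j. m \<le> i + j}"
  shows "\<phi> f \<in> ideal_gen {\<phi> a ^ i * \<phi> b ^ j | i j. m \<le> i + j}"
proof -
  have "\<phi> ` {a ^ i * b ^ j | i j. m \<le> i + j} \<subseteq> {\<phi> a ^ i * \<phi> b ^ j | i j. m \<le> i + j}"
    by (auto simp del: power_Suc) blast
  from ideal_gen_mono[OF this] hom_ideal_gen[OF assms] show ?thesis by blast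
qed

lemma hom_dvd_ideal_gen:
  assumes "\<And>s. s \<in> S \<Longrightarrow> d dvd \<phi> s" and "a \<in> ideal_gen S"
  shows "d dvd \<phi> a"
  using assms(2) by (induction rule: ideal_gen_induct) (auto intro!: dvd_add dvd_mult assms(1))

lemma hom_dvd_ideal_power:
  assumes "\<And>a. a \<in> J \<Longrightarrow> d dvd \<phi> a" and "f \<in> ideal_power J r"
  shows "d ^ r dvd \<phi> f"
  using assms(2)
proof (induction r arbitrary: f)
  case (Suc r)
  have "d ^ Suc r dvd \<phi> s" if "s \<in> {a * b | a b. a \<in> J \<and> b \<in> ideal_power J r}" for s
    using that assms(1) Suc.IH by (auto intro!: mult_dvd_mono)
  moreover have "f \<in> ideal_gen {a * b | a b. a \<in> J \<and> b \<in> ideal_power J r}"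
    using Suc.prems by simp
  ultimately show ?case by (rule hom_dvd_ideal_gen)
qed simp

end

lemma unital_hom_compose: "unital_hom f \<Longrightarrow> unital_hom g \<Longrightarrow> unital_hom (\<lambda>x. f (g x))"
  by (simp add: unital_hom_def)

lemma unital_hom_const: "unital_hom (\<lambda>c::'a::comm_ring_1. [:c:])"
  by unfold_locales (auto simp: pCons_one)

text \<open>
  The extension of a map \<open>h\<close> of coefficient rings to polynomials in one variable, sending the
  variable to \<open>u\<close>.
\<close>

definition extend_hom :: "('r::comm_ring_1 \<Rightarrow> 's::comm_ring_1) \<Rightarrow> 's \<Rightarrow> 'r poly \<Rightarrow> 's" where
  "extend_hom h u p = poly (map_poly h p) u"

context
  fixes h :: "'r::comm_ring_1 \<Rightarrow> 's::comm_ring_1"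
  assumes h: "unital_hom h"
begin

interpretation unital_hom h by (rule h)

lemma extend_hom_pCons: "extend_hom h u (pCons a p) = h a + u * extend_hom h u p"
  by (simp add: extend_hom_def map_poly_pCons)

lemma extend_hom_0: "extend_hom h u 0 = 0"
  by (simp add: extend_hom_def)

lemma extend_hom_const: "extend_hom h u [:c:] = h c"
  using extend_hom_pCons[of u c 0] by (simp add: extend_hom_0)

lemma extend_hom_var: "extend_hom h u [:0, 1:] = u"
  by (simp add: extend_hom_pCons extend_hom_0)

lemma extend_hom_add: "extend_hom h u (p + q) = extend_hom h u p + extend_hom h u q"
  by (induction p q rule: poly_induct2) (auto simp: extend_hom_pCons extend_hom_0 algebra_simps)

lemma extend_hom_smult: "extend_hom h u (smult c p) = h c * extend_hom h u p"
  by (induction p) (auto simp: extend_hom_pCons extend_hom_0 algebra_simps)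

lemma extend_hom_mult: "extend_hom h u (p * q) = extend_hom h u p * extend_hom h u q"
  by (induction p)
    (auto simp: extend_hom_pCons extend_hom_0 extend_hom_add extend_hom_smult algebra_simps)

lemma unital_hom_extend: "unital_hom (extend_hom h u)"
  using extend_hom_const[of u 1]
  by unfold_locales (auto simp: extend_hom_add extend_hom_mult pCons_one)

end

lemma unital_hom_poly_eqI:
  assumes "unital_hom f" "unital_hom g"
    and "\<And>c. f [:c:] = g [:c:]" and "f [:0, 1:] = g [:0, 1:]"
  shows "f p = g p"
proof -
  interpret f: unital_hom f by (rule assms)
  interpret g: unital_hom g by (rule assms)
  show ?thesis
  proof (induction p)
    case (pCons a p)
    have "pCons a p = [:a:] + [:0, 1:] * p" by simp
    then show ?case using pCons assms(3,4) by (simp only: f.hom_add f.hom_mult g.hom_add g.hom_mult)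
  qed simp
qed

section \<open>Homomorphisms out of $K[x,y,z]$\<close>

text \<open>
  Evaluation at a point \<open>r\<close> with coordinates in a ring into which the coefficients are mapped by \<open>h\<close>.
  For \<open>h\<close> the identity this is \<^const>\<open>eval3\<close>.
\<close>

definition eval_hom :: "('a::comm_ring_1 \<Rightarrow> 's::comm_ring_1) \<Rightarrow> (3 \<Rightarrow> 's) \<Rightarrow> 'a poly3 \<Rightarrow> 's" where
  "eval_hom h r f = (\<Sum>t\<in>Poly_Mapping.keys f.
     h (Poly_Mapping.lookup f t) * (\<Prod>i\<in>UNIV. r i ^ Poly_Mapping.lookup t i))"

text \<open>The constant polynomials and the three variables.\<close>

definition Const :: "'a::comm_ring_1 \<Rightarrow> 'a poly3" where
  "Const c = Poly_Mapping.single 0 c"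

definition Var :: "3 \<Rightarrow> 'a::comm_ring_1 poly3" where
  "Var i = Poly_Mapping.single (Poly_Mapping.single i 1) 1"

lemma eval3_eq_eval_hom: "eval3 f v = eval_hom (\<lambda>c. c) (\<lambda>i. v $ i) f"
  by (simp add: eval3_def eval_hom_def)

lemma unital_hom_Const: "unital_hom (Const :: 'a::comm_ring_1 \<Rightarrow> _)"
  by unfold_locales (auto simp: Const_def single_add mult_single)

lemma poly3_sum_single:
  "(\<Sum>t\<in>Poly_Mapping.keys f. Poly_Mapping.single t (Poly_Mapping.lookup f t)) = f"
  (is "?g = f")
proof (rule poly_mapping_eqI)
  fix k
  have "Poly_Mapping.lookup ?g k = (\<Sum>t\<in>Poly_Mapping.keys f. if t = k then Poly_Mapping.lookup f t else 0)"
    by (simp add: lookup_sum lookup_single when_def)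
  then show "Poly_Mapping.lookup ?g k = Poly_Mapping.lookup f k"
    by (simp add: in_keys_iff)
qed

context
  fixes h :: "'a::comm_ring_1 \<Rightarrow> 's::comm_ring_1"
  assumes h: "unital_hom h"
begin

interpretation unital_hom h by (rule h)

lemma eval_hom_superset:
  assumes "finite A" "Poly_Mapping.keys f \<subseteq> A"
  shows "eval_hom h r f =
    (\<Sum>t\<in>A. h (Poly_Mapping.lookup f t) * (\<Prod>i\<in>UNIV. r i ^ Poly_Mapping.lookup t i))"
  unfolding eval_hom_def using assms
  by (intro sum.mono_neutral_left) (auto simp: in_keys_iff)

lemma eval_hom_add: "eval_hom h r (f + g) = eval_hom h r f + eval_hom h r g"
proof -
  define A where "A = Poly_Mapping.keys f \<union> Poly_Mapping.keys g"
  have A: "finite A" "Poly_Mapping.keys f \<subseteq> A" "Poly_Mapping.keys g \<subseteq> A"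
      "Poly_Mapping.keys (f + g) \<subseteq> A"
    unfolding A_def using keys_add[of f g] by auto
  show ?thesis
    by (simp add: eval_hom_superset[OF A(1,2)] eval_hom_superset[OF A(1,3)]
        eval_hom_superset[OF A(1,4)] lookup_add sum.distrib algebra_simps)
qed

lemma eval_hom_single:
  "eval_hom h r (Poly_Mapping.single t c) = h c * (\<Prod>i\<in>UNIV. r i ^ Poly_Mapping.lookup t i)"
  by (subst eval_hom_superset[of "{t}"]) (auto simp: lookup_single)

lemma eval_hom_sum: "eval_hom h r (sum f A) = (\<Sum>i\<in>A. eval_hom h r (f i))"
  by (induction A rule: infinite_finite_induct) (auto simp: eval_hom_add, simp_all add: eval_hom_def)

lemma eval_hom_mult: "eval_hom h r (f * g) = eval_hom h r f * eval_hom h r g"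
proof -
  let ?s = "\<lambda>f t. Poly_Mapping.single t (Poly_Mapping.lookup f t)"
  have single: "eval_hom h r (?s f t * ?s g u) = eval_hom h r (?s f t) * eval_hom h r (?s g u)"
    for t u
    by (simp add: mult_single eval_hom_single lookup_add power_add prod.distrib algebra_simps)
  have "eval_hom h r (f * g)
      = eval_hom h r ((\<Sum>t\<in>Poly_Mapping.keys f. ?s f t) * (\<Sum>u\<in>Poly_Mapping.keys g. ?s g u))"
    by (simp only: poly3_sum_single)
  also have "\<dots> = eval_hom h r (\<Sum>t\<in>Poly_Mapping.keys f. ?s f t)
      * eval_hom h r (\<Sum>u\<in>Poly_Mapping.keys g. ?s g u)"
    by (simp add: sum_product eval_hom_sum single)
  finally show ?thesis
    by (simp only: poly3_sum_single)
qed

lemma eval_hom_Const: "eval_hom h r (Const c) = h c"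
  by (simp add: Const_def eval_hom_single)

lemma eval_hom_Var: "eval_hom h r (Var i) = r i"
proof -
  have "(\<Prod>j\<in>UNIV. r j ^ Poly_Mapping.lookup (Poly_Mapping.single i 1) j)
      = (\<Prod>j\<in>UNIV. if j = i then r i else 1)"
    by (intro prod.cong) (auto simp: lookup_single when_def)
  then show ?thesis by (simp add: Var_def eval_hom_single)
qed

lemma unital_hom_eval: "unital_hom (eval_hom h r)"
  using eval_hom_Const[of r 1]
  by unfold_locales (auto simp: eval_hom_add eval_hom_mult Const_def)

end

lemma single_eq_Const_Var:
  "Poly_Mapping.single t c = Const c * (\<Prod>i\<in>UNIV. Var i ^ Poly_Mapping.lookup t i)"
proof -
  have pow: "Var i ^ k = Poly_Mapping.single (Poly_Mapping.single i k) 1" for i :: 3 and k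
    by (induction k) (auto simp: Var_def mult_single single_add[symmetric])
  have "(\<Sum>i\<in>UNIV. Poly_Mapping.single i (Poly_Mapping.lookup t i)) = t"
    by (rule poly_mapping_eqI) (simp add: lookup_sum lookup_single when_def)
  moreover have "(\<Prod>i\<in>A. Poly_Mapping.single (g i) 1) = Poly_Mapping.single (\<Sum>i\<in>A. g i) (1::'a)"
    if "finite A" for A :: "3 set" and g :: "3 \<Rightarrow> 3 \<Rightarrow>\<^sub>0 nat"
    using that by (induction A rule: finite_induct) (auto simp: mult_single)
  ultimately show ?thesis by (simp add: pow Const_def mult_single)
qed

lemma unital_hom_poly3_eqI:
  assumes "unital_hom f" "unital_hom g"
    and "\<And>c. f (Const c) = g (Const c)" and "\<And>i. f (Var i) = g (Var i)"
  shows "f p = g p"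
proof -
  interpret f: unital_hom f by (rule assms)
  interpret g: unital_hom g by (rule assms)
  have "f (Poly_Mapping.single t c) = g (Poly_Mapping.single t c)" for t c
    by (simp only: single_eq_Const_Var f.hom_mult g.hom_mult f.hom_prod g.hom_prod
        f.hom_power g.hom_power assms(3,4))
  then have "f (\<Sum>t\<in>A. Poly_Mapping.single t (u t)) = g (\<Sum>t\<in>A. Poly_Mapping.single t (u t))"
    for A u by (simp only: f.hom_sum g.hom_sum)
  from this[of "Poly_Mapping.lookup p" "Poly_Mapping.keys p"] show ?thesis
    by (simp only: poly3_sum_single)
qed

section \<open>Linear coordinates\<close>

text \<open>The linear form with coefficient vector \<open>w\<close>.\<close>

definition lin :: "'a::comm_ring_1 ^ 3 \<Rightarrow> 'a poly3" where
  "lin w = (\<Sum>i\<in>UNIV. Const (w $ i) * Var i)"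

text \<open>
  Three coefficient vectors form a frame if the linear forms they define are linearly independent,
  that is, can serve as homogeneous coordinates.
\<close>

definition frame :: "'a::field ^ 3 \<Rightarrow> 'a ^ 3 \<Rightarrow> 'a ^ 3 \<Rightarrow> bool" where
  "frame u v w \<longleftrightarrow> det (vector [u, v, w] :: 'a ^ 3 ^ 3) \<noteq> 0"

lemma frame_iff:
  "frame u v w \<longleftrightarrow>
     u $ 1 * (v $ 2 * w $ 3 - v $ 3 * w $ 2) - u $ 2 * (v $ 1 * w $ 3 - v $ 3 * w $ 1)
     + u $ 3 * (v $ 1 * w $ 2 - v $ 2 * w $ 1) \<noteq> 0"
  unfolding frame_def det_3 vector_3
  by (simp add: algebra_simps)

lemma frame_swap12: "frame u v w \<Longrightarrow> frame v u w"
  unfolding frame_iff by (auto simp: algebra_simps)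

lemma frame_swap23: "frame u v w \<Longrightarrow> frame u w v"
  unfolding frame_iff by (auto simp: algebra_simps)

lemma eval3_lin: "eval3 (lin w) v = (\<Sum>i\<in>UNIV. w $ i * v $ i)"
proof -
  have id: "unital_hom (\<lambda>c::'a. c)" by unfold_locales auto
  interpret unital_hom "eval_hom (\<lambda>c::'a. c) (\<lambda>i. v $ i)" by (rule unital_hom_eval[OF id])
  show ?thesis
    by (simp add: eval3_eq_eval_hom lin_def eval_hom_Const[OF id] eval_hom_Var[OF id])
qed

lemma eval3_lin_explicit: "eval3 (lin w) v = w $ 1 * v $ 1 + w $ 2 * v $ 2 + w $ 3 * v $ 3"
  by (simp add: eval3_lin sum_3)

lemma lin_add: "lin (u + v) = lin u + lin v"
  by (simp add: lin_def sum.distrib distrib_right unital_hom.hom_add[OF unital_hom_Const])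

lemma lin_scale: "lin (c *s u) = Const c * lin u"
  by (simp add: lin_def sum_distrib_left mult.assoc unital_hom.hom_mult[OF unital_hom_Const])

lemma frame_inverse:
  fixes u v w :: "'a::field ^ 3"
  assumes "frame u v w"
  shows "\<exists>B :: 'a ^ 3 ^ 3. vector [u, v, w] ** B = mat 1 \<and> B ** vector [u, v, w] = mat 1"
  using assms by (simp add: frame_def flip: invertible_det_nz) (simp add: invertible_def)

lemma matrix_mult_mat_1_entry:
  "A ** B = mat 1 \<Longrightarrow> (\<Sum>i\<in>UNIV. A $ j $ i * B $ i $ k) = (if j = k then 1 else 0)"
  by (auto simp: matrix_matrix_mult_def mat_def vec_eq_iff)

lemma frame_vanishing_imp_0:
  assumes "frame u v w" "eval3 (lin u) p = 0" "eval3 (lin v) p = 0" "eval3 (lin w) p = 0"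
  shows "p = 0"
proof -
  let ?A = "vector [u, v, w] :: 'a ^ 3 ^ 3"
  obtain B where "B ** ?A = mat 1"
    using frame_inverse[OF assms(1)] by blast
  note B = matrix_mult_mat_1_entry[OF this]
  have z: "(\<Sum>k\<in>UNIV. ?A $ i $ k * p $ k) = 0" for i
    using assms(2-4) exhaust_3[of i] by (auto simp: eval3_lin)
  have "p $ j = 0" for j
  proof -
    have "p $ j = (\<Sum>k\<in>UNIV. (\<Sum>i\<in>UNIV. B $ j $ i * ?A $ i $ k) * p $ k)"
      by (simp add: B if_distrib if_distribR cong: if_cong)
    also have "\<dots> = (\<Sum>i\<in>UNIV. B $ j $ i * (\<Sum>k\<in>UNIV. ?A $ i $ k * p $ k))"
      unfolding sum_distrib_left sum_distrib_right mult.assoc by (rule sum.swap)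
    finally show ?thesis by (simp add: z)
  qed
  then show ?thesis by (simp add: vec_eq_iff)
qed

text \<open>
  Linear forms that make up a frame are algebraically independent generators of the polynomial
  ring: a homomorphism may be prescribed on them.
\<close>

lemma frame_hom_exists:
  fixes h :: "'a::field \<Rightarrow> 's::comm_ring_1"
  assumes fr: "frame u v w" and h: "unital_hom h"
  obtains \<theta> where "unital_hom \<theta>" "\<And>c. \<theta> (Const c) = h c"
    "\<theta> (lin u) = a" "\<theta> (lin v) = b" "\<theta> (lin w) = c"
proof -
  interpret h: unital_hom h by (rule h)
  let ?A = "vector [u, v, w] :: 'a ^ 3 ^ 3"
  obtain B where "?A ** B = mat 1"
    using frame_inverse[OF fr] by blast
  note B = matrix_mult_mat_1_entry[OF this]
  define r where "r i = (\<Sum>k\<in>UNIV. h (B $ i $ k) * (vector [a, b, c] :: 's ^ 3) $ k)" for i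
  interpret \<theta>: unital_hom "eval_hom h r" by (rule unital_hom_eval[OF h])
  have *: "eval_hom h r (lin (?A $ j)) = (vector [a, b, c] :: 's ^ 3) $ j" for j
  proof -
    have "eval_hom h r (lin (?A $ j)) = (\<Sum>i\<in>UNIV. h (?A $ j $ i) * r i)"
      by (simp add: lin_def eval_hom_Const[OF h] eval_hom_Var[OF h])
    also have "\<dots> = (\<Sum>k\<in>UNIV. h (\<Sum>i\<in>UNIV. ?A $ j $ i * B $ i $ k) * (vector [a, b, c] :: 's ^ 3) $ k)"
      unfolding r_def h.hom_sum h.hom_mult sum_distrib_left sum_distrib_right mult.assoc
      by (rule sum.swap)
    also have "\<dots> = (vector [a, b, c] :: 's ^ 3) $ j"
      by (simp add: B if_distrib if_distribR cong: if_cong)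
    finally show ?thesis .
  qed
  show ?thesis
  proof (rule that)
    show "unital_hom (eval_hom h r)" by (rule \<theta>.unital_hom_axioms)
    show "eval_hom h r (Const c) = h c" for c by (rule eval_hom_Const[OF h])
    show "eval_hom h r (lin u) = a" "eval_hom h r (lin v) = b" "eval_hom h r (lin w) = c"
      using *[of 1] *[of 2] *[of 3] by simp_all
  qed
qed

lemma frame_Var:
  assumes "frame u v w"
  obtains b1 b2 b3 where "Var i = Const b1 * lin u + Const b2 * lin v + Const b3 * lin w"
proof -
  interpret C: unital_hom Const by (rule unital_hom_Const)
  let ?A = "vector [u, v, w] :: 'a ^ 3 ^ 3"
  obtain B where "B ** ?A = mat 1"
    using frame_inverse[OF assms(1)] by blast
  note B = matrix_mult_mat_1_entry[OF this]
  have "(\<Sum>k\<in>UNIV. Const (B $ i $ k) * lin (?A $ k))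
      = (\<Sum>j\<in>UNIV. Const (\<Sum>k\<in>UNIV. B $ i $ k * ?A $ k $ j) * Var j)"
    unfolding lin_def C.hom_sum C.hom_mult sum_distrib_left sum_distrib_right mult.assoc
    by (rule sum.swap)
  also have "\<dots> = Var i"
    by (simp add: B if_distrib if_distribR cong: if_cong)
  finally have "Var i = Const (B $ i $ 1) * lin u + Const (B $ i $ 2) * lin v
      + Const (B $ i $ 3) * lin w"
    by (simp add: sum_3)
  then show ?thesis by (rule that)
qed

text \<open>
  The homomorphism from the iterated polynomial ring that sends the outermost variable to \<open>a\<close>,
  the middle one to \<open>b\<close> and the innermost one to \<open>c\<close>.
\<close>

definition coord_hom ::
  "'a::comm_ring_1 poly3 \<Rightarrow> 'a poly3 \<Rightarrow> 'a poly3 \<Rightarrow> 'a poly poly poly \<Rightarrow> 'a poly3" where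
  "coord_hom a b c = extend_hom (extend_hom (extend_hom Const c) b) a"

lemma unital_hom_coord: "unital_hom (coord_hom a b c)"
  unfolding coord_hom_def by (intro unital_hom_extend unital_hom_Const)

lemma coord_hom_const: "coord_hom a b c [:p:] = extend_hom (extend_hom Const c) b p"
  unfolding coord_hom_def
  by (intro extend_hom_const unital_hom_extend unital_hom_Const)

lemma coord_hom_const2: "coord_hom a b c [:[:p:]:] = extend_hom Const c p"
  unfolding coord_hom_const
  by (intro extend_hom_const unital_hom_extend unital_hom_Const)

lemma coord_hom_const3: "coord_hom a b c [:[:[:x:]:]:] = Const x"
  unfolding coord_hom_const2
  by (intro extend_hom_const unital_hom_extend unital_hom_Const)

lemma coord_hom_vars:
  "coord_hom a b c [:0, 1:] = a"
  "coord_hom a b c [:[:0, 1:]:] = b"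
  "coord_hom a b c [:[:[:0, 1:]:]:] = c"
proof -
  show "coord_hom a b c [:0, 1:] = a"
    unfolding coord_hom_def by (intro extend_hom_var unital_hom_extend unital_hom_Const)
  show "coord_hom a b c [:[:0, 1:]:] = b"
    unfolding coord_hom_const by (intro extend_hom_var unital_hom_extend unital_hom_Const)
  show "coord_hom a b c [:[:[:0, 1:]:]:] = c"
    unfolding coord_hom_const2 by (intro extend_hom_var unital_hom_Const)
qed

lemma frame_iso:
  assumes fr: "frame u v w"
  obtains \<psi> :: "'a::field poly3 \<Rightarrow> 'a poly poly poly" where "unital_hom \<psi>"
    "\<And>f. coord_hom (lin u) (lin v) (lin w) (\<psi> f) = f"
    "\<And>p. \<psi> (coord_hom (lin u) (lin v) (lin w) p) = p"
proof -
  let ?c = "\<lambda>x::'a. [:[:[:x:]:]:]"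
  have h: "unital_hom ?c"
    by (intro unital_hom_compose[OF unital_hom_const] unital_hom_const)
  obtain \<psi> where \<psi>: "unital_hom \<psi>" "\<And>x. \<psi> (Const x) = ?c x"
    "\<psi> (lin u) = [:0, 1:]" "\<psi> (lin v) = [:[:0, 1:]:]" "\<psi> (lin w) = [:[:[:0, 1:]:]:]"
    using frame_hom_exists[OF fr h, of "[:0, 1:]" "[:[:0, 1:]:]" "[:[:[:0, 1:]:]:]"] by metis
  interpret \<psi>: unital_hom \<psi> by (rule \<psi>)
  let ?C = "coord_hom (lin u) (lin v) (lin w)"
  interpret C: unital_hom ?C by (rule unital_hom_coord)
  note cp = unital_hom_compose[OF _ unital_hom_const]
  have id: "unital_hom (\<lambda>x::'b::comm_ring_1. x)" by unfold_locales auto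
  have 1: "?C (\<psi> f) = f" for f
  proof (rule unital_hom_poly3_eqI[of "\<lambda>f. ?C (\<psi> f)" "\<lambda>f. f"])
    show "unital_hom (\<lambda>f. ?C (\<psi> f))"
      by (rule unital_hom_compose[OF C.unital_hom_axioms \<psi>.unital_hom_axioms])
    show "?C (\<psi> (Const c)) = Const c" for c by (simp add: \<psi> coord_hom_const3)
    show "?C (\<psi> (Var i)) = Var i" for i
    proof -
      obtain b1 b2 b3 where "Var i = Const b1 * lin u + Const b2 * lin v + Const b3 * lin w"
        using frame_Var[OF fr] by metis
      then show ?thesis by (simp only: \<psi>.hom_add \<psi>.hom_mult \<psi> C.hom_add C.hom_mult
            coord_hom_const3 coord_hom_vars)
    qed
  qed (rule id)
  have comp: "unital_hom (\<lambda>p. \<psi> (?C p))"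
    by (rule unital_hom_compose[OF \<psi>.unital_hom_axioms C.unital_hom_axioms])
  have 2: "\<psi> (?C p) = p" for p
  proof (rule unital_hom_poly_eqI[of "\<lambda>p. \<psi> (?C p)" "\<lambda>p. p"])
    show "\<psi> (?C [:q:]) = [:q:]" for q
    proof (rule unital_hom_poly_eqI[of "\<lambda>q. \<psi> (?C [:q:])" "\<lambda>q. [:q:]"])
      show "\<psi> (?C [:[:r:]:]) = [:[:r:]:]" for r
        by (rule unital_hom_poly_eqI[of "\<lambda>r. \<psi> (?C [:[:r:]:])" "\<lambda>r. [:[:r:]:]"])
          (use cp[OF cp[OF comp]] cp[OF unital_hom_const] in
            \<open>simp_all add: coord_hom_const3 coord_hom_vars \<psi>\<close>)
    qed (use cp[OF comp] unital_hom_const in \<open>simp_all add: coord_hom_vars \<psi>\<close>)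
  qed (simp_all add: comp id coord_hom_vars \<psi>)
  show ?thesis by (rule that[OF \<psi>(1) 1 2])
qed

section \<open>Intersections of powers of ideals with two generators\<close>

text \<open>
  In \<open>T[X]\<close>, membership in the power of \<open>(X, l)\<close> with a constant \<open>l\<close> is a divisibility
  condition on each coefficient. The subtraction is truncated: from degree \<open>m\<close> on there is
  no condition.
\<close>

lemma mem_pair_power_poly_iff:
  fixes l :: "'t::comm_ring_1"
  shows "p \<in> ideal_gen {[:0, 1:] ^ i * [:l:] ^ j | i j. m \<le> i + j} \<longleftrightarrow>
    (\<forall>t. l ^ (m - t) dvd coeff p t)"
proof
  assume "p \<in> ideal_gen {[:0, 1:] ^ i * [:l:] ^ j | i j. m \<le> i + j}"
  then show "\<forall>t. l ^ (m - t) dvd coeff p t"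
  proof (induction rule: ideal_gen_induct)
    case (step r s b)
    from step(1) obtain i j where s: "s = [:0, 1:] ^ i * [:l:] ^ j" and ij: "m \<le> i + j" by blast
    have s': "s = monom (l ^ j) i"
      by (simp add: s poly_const_pow monom_altdef)
    show ?case
    proof
      fix t
      have "l ^ (m - t) dvd coeff r k * coeff s (t - k)" for k
      proof (cases "t - k = i")
        case True
        then have "m - t \<le> j" using ij by simp
        then show ?thesis by (simp add: s' le_imp_power_dvd)
      qed (simp add: s')
      then show "l ^ (m - t) dvd coeff (r * s + b) t"
        using step.IH by (simp add: coeff_mult dvd_add dvd_sum)
    qed
  qed simp
next
  assume dvd: "\<forall>t. l ^ (m - t) dvd coeff p t"
  have "monom (coeff p t) t \<in> ideal_gen {[:0, 1:] ^ i * [:l:] ^ j | i j. m \<le> i + j}" for t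
  proof -
    obtain c where c: "coeff p t = l ^ (m - t) * c" using dvd by (meson dvdE)
    have "[:0, 1:] ^ t * [:l:] ^ (m - t) \<in> ideal_gen {[:0, 1:] ^ i * [:l:] ^ j | i j. m \<le> i + j}"
      by (rule pair_gen_base) simp
    then have "[:c:] * ([:0, 1:] ^ t * [:l:] ^ (m - t))
        \<in> ideal_gen {[:0, 1:] ^ i * [:l:] ^ j | i j. m \<le> i + j}"
      by (rule ideal_gen_mult)
    also have "[:c:] * ([:0, 1:] ^ t * [:l:] ^ (m - t)) = monom (coeff p t) t"
      by (simp add: c monom_altdef poly_const_pow mult.commute)
    finally show ?thesis .
  qed
  then have "(\<Sum>t\<le>degree p. monom (coeff p t) t)
      \<in> ideal_gen {[:0, 1:] ^ i * [:l:] ^ j | i j. m \<le> i + j}"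
    by (intro ideal_gen_sum)
  then show "p \<in> ideal_gen {[:0, 1:] ^ i * [:l:] ^ j | i j. m \<le> i + j}"
    by (simp add: poly_as_sum_of_monoms)
qed

lemma prime_power_dvd_mult_cancel:
  fixes P :: "'t::idom"
  assumes "prime_elem P" "\<not> P dvd Q" "P ^ k dvd Q * h"
  shows "P ^ k dvd h"
  using assms(3)
proof (induction k arbitrary: h)
  case (Suc k)
  have "P dvd Q * h" using Suc.prems by (metis dvd_mult_left power_Suc)
  then have "P dvd h" using assms(1,2) prime_elem_dvd_mult_iff by blast
  then obtain h' where h': "h = P * h'" by (elim dvdE)
  have "P \<noteq> 0" using assms(1) by (rule prime_elem_not_zeroI)
  moreover have "P * P ^ k dvd P * (Q * h')" using Suc.prems h' by (simp add: mult.left_commute)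
  ultimately have "P ^ k dvd Q * h'" by (simp only: dvd_times_left_cancel_iff dvd_mult_cancel_left) simp
  then have "P ^ k dvd h'" by (rule Suc.IH)
  then show ?case by (simp add: h')
qed simp

lemma prime_elem_dvd_prodE:
  assumes "prime_elem P" "finite S" "P dvd prod f S"
  obtains i where "i \<in> S" "P dvd f i"
  using assms(2,3) that
proof (induction S arbitrary: thesis rule: finite_induct)
  case empty
  then show ?case using prime_elem_not_unit[OF assms(1)] by simp
next
  case (insert i S)
  then show ?case using prime_elem_dvd_mult_iff[OF assms(1)] by auto
qed

lemma prod_prime_power_dvd:
  fixes P :: "'i \<Rightarrow> 't::idom"
  assumes "finite S" "\<And>i. i \<in> S \<Longrightarrow> prime_elem (P i)"
    and "\<And>i j. i \<in> S \<Longrightarrow> j \<in> S \<Longrightarrow> i \<noteq> j \<Longrightarrow> \<not> P i dvd P j"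
    and "\<And>i. i \<in> S \<Longrightarrow> P i ^ k dvd h"
  shows "(\<Prod>i\<in>S. P i) ^ k dvd h"
  using assms
proof (induction S rule: finite_induct)
  case (insert i S)
  have "(\<Prod>i\<in>S. P i) ^ k dvd h" using insert by blast
  then obtain h' where h': "h = (\<Prod>i\<in>S. P i) ^ k * h'" by (elim dvdE)
  have "\<not> P i dvd (\<Prod>i\<in>S. P i)"
  proof
    assume "P i dvd (\<Prod>i\<in>S. P i)"
    then obtain j where "j \<in> S" "P i dvd P j"
      using prime_elem_dvd_prodE[OF insert.prems(1)[OF insertI1] insert.hyps(1)] by blast
    then show False using insert.prems(2)[of i j] insert.hyps by auto
  qed
  then have "\<not> P i dvd (\<Prod>i\<in>S. P i) ^ k"
    using insert.prems(1) prime_elem_dvd_power by blast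
  moreover have "P i ^ k dvd (\<Prod>i\<in>S. P i) ^ k * h'"
    using insert.prems(3)[OF insertI1] unfolding h' .
  ultimately have "P i ^ k dvd h'"
    by (rule prime_power_dvd_mult_cancel[OF insert.prems(1)[OF insertI1]])
  then have "(\<Prod>i\<in>S. P i) ^ k * P i ^ k dvd h"
    unfolding h' by (intro mult_dvd_mono dvd_refl)
  moreover have "(\<Prod>j\<in>insert i S. P j) ^ k = (\<Prod>i\<in>S. P i) ^ k * P i ^ k"
    using insert.hyps by (simp add: power_mult_distrib)
  ultimately show ?case by (simp only:)
qed simp

text \<open>The linear form with coefficient \<open>b\<close> at the outer variable and \<open>c\<close> at the inner one.\<close>

definition lform :: "'a::comm_ring_1 \<Rightarrow> 'a \<Rightarrow> 'a poly poly" where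
  "lform b c = [:[:0, c:], [:b:]:]"

lemma prime_elem_lform:
  assumes "b \<noteq> 0 \<or> c \<noteq> (0::'a::field)"
  shows "prime_elem (lform b c)"
proof (cases "b = 0")
  case True
  then have "prime_elem [:0, c:]"
    using assms by (intro prime_elem_linear_field_poly) auto
  then have "prime_elem [:[:0, c:]:]" by (rule lift_prime_elem_poly)
  then show ?thesis using True by (simp add: lform_def)
next
  case False
  let ?r = "[:0, - (c / b):]"
  have root: "lform b c dvd p \<longleftrightarrow> poly p ?r = 0" for p
  proof -
    have "lform b c = [:[:b:]:] * [:- ?r, 1:]" using False by (simp add: lform_def)
    moreover have "is_unit [:[:b:]:]" using False by (simp add: is_unit_const_poly_iff dvd_field_iff)
    ultimately have "lform b c dvd p \<longleftrightarrow> [:- ?r, 1:] dvd p"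
      by (metis mult_unit_dvd_iff')
    then show ?thesis by (simp only: poly_eq_0_iff_dvd)
  qed
  show ?thesis
    unfolding prime_elem_def root using False by (auto simp: lform_def root[unfolded lform_def])
qed

lemma lform_not_dvd:
  assumes "b * c' \<noteq> b' * (c::'a::field)"
  shows "\<not> lform b c dvd lform b' c'"
proof
  have 1: "unital_hom (extend_hom (\<lambda>c::'a. [:c:]) [:0, b:])"
    by (intro unital_hom_extend unital_hom_const)
  let ?k = "extend_hom (extend_hom (\<lambda>c. [:c:]) [:0, b:]) [:0, - c:]"
  interpret k: unital_hom ?k by (rule unital_hom_extend[OF 1])
  have k: "?k (lform x y) = [:0, b * y - x * c:]" for x y
    by (simp add: lform_def extend_hom_pCons[OF 1] extend_hom_0[OF 1]
        extend_hom_pCons[OF unital_hom_const] extend_hom_0[OF unital_hom_const] algebra_simps)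
  assume "lform b c dvd lform b' c'"
  then obtain q where "lform b' c' = lform b c * q" by (elim dvdE)
  then have "?k (lform b' c') = ?k (lform b c) * ?k q" by simp
  then show False using assms unfolding k by simp
qed

text \<open>
  The intersection of the \<open>m\<close>-th powers of the ideals \<open>(u, l\<^sub>i)\<close>, where the \<open>l\<^sub>i\<close> are pairwise
  independent linear forms in the two other coordinates, lies in the \<open>m\<close>-th power of the ideal
  generated by \<open>u\<close> and the product of the \<open>l\<^sub>i\<close>.
\<close>

lemma inter_pair_powers:
  fixes b c :: "'i \<Rightarrow> 'a::field"
  assumes fr: "frame u v w" and fin: "finite S"
    and l: "\<And>i. i \<in> S \<Longrightarrow> l i = Const (b i) * lin v + Const (c i) * lin w"
    and nz: "\<And>i. i \<in> S \<Longrightarrow> b i \<noteq> 0 \<or> c i \<noteq> 0"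
    and indep: "\<And>i j. i \<in> S \<Longrightarrow> j \<in> S \<Longrightarrow> i \<noteq> j \<Longrightarrow> b i * c j \<noteq> b j * c i"
    and f: "\<And>i. i \<in> S \<Longrightarrow> f \<in> ideal_gen {lin u ^ s * l i ^ t | s t. m \<le> s + t}"
  shows "f \<in> ideal_gen {lin u ^ s * (\<Prod>i\<in>S. l i) ^ t | s t. m \<le> s + t}"
proof -
  let ?C = "coord_hom (lin u) (lin v) (lin w)"
  interpret C: unital_hom ?C by (rule unital_hom_coord)
  obtain \<psi> where \<psi>: "unital_hom \<psi>" "\<And>f. ?C (\<psi> f) = f" "\<And>p. \<psi> (?C p) = p"
    using frame_iso[OF fr] by metis
  interpret \<psi>: unital_hom \<psi> by (rule \<psi>)
  have C_l: "?C [:lform (b i) (c i):] = l i" if "i \<in> S" for i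
  proof -
    have "[:lform (b i) (c i):] = [:[:[:b i:]:]:] * [:[:0, 1:]:] + [:[:[:c i:]:]:] * [:[:[:0, 1:]:]:]"
      by (simp add: lform_def)
    then show ?thesis
      by (simp only: C.hom_add C.hom_mult coord_hom_const3 coord_hom_vars l[OF that])
  qed
  have "lform (b i) (c i) ^ (m - t) dvd coeff (\<psi> f) t" if i: "i \<in> S" for i t
  proof -
    have "\<psi> (lin u) = [:0, 1:]" using \<psi>(3)[of "[:0, 1:]"] by (simp add: coord_hom_vars)
    moreover have "\<psi> (l i) = [:lform (b i) (c i):]" using \<psi>(3) C_l[OF i] by metis
    ultimately have "\<psi> f \<in> ideal_gen {[:0, 1:] ^ s * [:lform (b i) (c i):] ^ t | s t. m \<le> s + t}"
      using \<psi>.hom_pair_power[OF f[OF i]] by simp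
    then show ?thesis by (simp only: mem_pair_power_poly_iff)
  qed
  then have "(\<Prod>i\<in>S. lform (b i) (c i)) ^ (m - t) dvd coeff (\<psi> f) t" for t
    using fin nz indep by (intro prod_prime_power_dvd prime_elem_lform lform_not_dvd) auto
  then have "\<psi> f \<in> ideal_gen {[:0, 1:] ^ s * [:\<Prod>i\<in>S. lform (b i) (c i):] ^ t | s t. m \<le> s + t}"
    by (simp only: mem_pair_power_poly_iff) simp
  moreover have "?C [:\<Prod>i\<in>S. lform (b i) (c i):] = (\<Prod>i\<in>S. l i)"
  proof -
    interpret c: unital_hom "\<lambda>c::'a poly poly. [:c:]" by (rule unital_hom_const)
    show ?thesis using C_l by (simp add: c.hom_prod)
  qed
  ultimately show ?thesis
    using C.hom_pair_power[of "\<psi> f" "[:0, 1:]" "[:\<Prod>i\<in>S. lform (b i) (c i):]" m]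
    by (simp only: \<psi> coord_hom_vars)
qed

section \<open>Ideals of points\<close>

lemma abs_proj_plane_eqI:
  assumes "u \<noteq> 0" "v \<noteq> 0" "s \<noteq> 0" "s *s v - t *s (u :: 'a::field ^ 3) = 0"
  shows "abs_proj_plane u = abs_proj_plane v"
proof -
  have "v = inverse s *s (s *s v)" using assms(3) by (simp add: vector_smult_assoc)
  also have "s *s v = t *s u" using assms(4) by simp
  finally have v: "v = (inverse s * t) *s u" by (simp only: vector_smult_assoc)
  moreover have "inverse s * t \<noteq> 0" using v assms(2) by (metis vector_smult_lzero)
  ultimately have "proportional u v" using assms(1,2) unfolding proportional_def by blast
  then show ?thesis using Quotient3_rel_abs[OF Quotient3_proj_plane] by blast
qed

lemma proportional_if_abs_proj_plane_eq:
  assumes "u \<noteq> 0" "v \<noteq> 0" "abs_proj_plane u = abs_proj_plane v"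
  shows "proportional u v"
proof -
  have "proportional w w" if "w \<noteq> 0" for w :: "'a ^ 3"
    using that by (auto simp: proportional_def intro!: exI[of _ 1])
  then show ?thesis using Quotient3_rel[OF Quotient3_proj_plane] assms by blast
qed

lemma rep_proj_plane_nonzero: "rep_proj_plane q \<noteq> 0"
  using Quotient3_rep_reflp[OF Quotient3_proj_plane, of q] by (simp add: proportional_def)

lemma abs_rep_proj_plane: "abs_proj_plane (rep_proj_plane q) = q"
  by (rule Quotient3_abs_rep[OF Quotient3_proj_plane])

lemma eval3_homogeneous_scale:
  assumes "homogeneous d f"
  shows "eval3 f (c *s v) = c ^ d * eval3 f v"
proof -
  have "(\<Prod>i\<in>UNIV. ((c *s v) $ i) ^ Poly_Mapping.lookup t i)
      = c ^ d * (\<Prod>i\<in>UNIV. (v $ i) ^ Poly_Mapping.lookup t i)"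
    if "t \<in> Poly_Mapping.keys f" for t
  proof -
    have "(\<Sum>i\<in>UNIV. Poly_Mapping.lookup t i) = d"
      using assms that by (simp add: homogeneous_def)
    then show ?thesis by (simp add: power_mult_distrib prod.distrib flip: power_sum)
  qed
  then show ?thesis
    by (simp add: eval3_def sum_distrib_left mult.left_commute)
qed

lemma vanishes_at_iff:
  assumes "homogeneous d f" "v \<noteq> 0"
  shows "vanishes_at f (abs_proj_plane v) \<longleftrightarrow> eval3 f v = 0"
proof
  assume "vanishes_at f (abs_proj_plane v)"
  then show "eval3 f v = 0"
    using assms(2) by (simp add: vanishes_at_def homogeneous_coords_def)
next
  assume z: "eval3 f v = 0"
  show "vanishes_at f (abs_proj_plane v)"
    unfolding vanishes_at_def homogeneous_coords_def
  proof (safe)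
    fix u :: "'a ^ 3" assume "u \<noteq> 0" "abs_proj_plane u = abs_proj_plane v"
    then obtain c where "u = c *s v"
      using proportional_if_abs_proj_plane_eq[of v u] assms(2) by (auto simp: proportional_def)
    then show "eval3 f u = 0" using eval3_homogeneous_scale[OF assms(1)] z by simp
  qed
qed

text \<open>The restriction of a form to the line through the origin in direction \<open>v\<close>.\<close>

lemma eval_hom_homogeneous:
  assumes "homogeneous d f"
  shows "eval_hom (\<lambda>c. [:c:]) (\<lambda>i. monom (v $ i) 1) f = monom (eval3 f v) d"
proof -
  have p: "(\<Prod>i\<in>UNIV. monom (v $ i) 1 ^ Poly_Mapping.lookup t i)
      = monom (\<Prod>i\<in>UNIV. (v $ i) ^ Poly_Mapping.lookup t i) d"
    if "t \<in> Poly_Mapping.keys f" for t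
  proof -
    have "(\<Prod>i\<in>A. monom (g i) (e i)) = monom (\<Prod>i\<in>A. g i) (\<Sum>i\<in>A. e i)"
      if "finite A" for A :: "3 set" and g :: "3 \<Rightarrow> 'a" and e
      using that by (induction A rule: finite_induct) (simp_all add: mult_monom)
    moreover have "(\<Sum>i\<in>UNIV. Poly_Mapping.lookup t i) = d"
      using assms that by (simp add: homogeneous_def)
    ultimately show ?thesis by (simp add: monom_power)
  qed
  have "eval_hom (\<lambda>c. [:c:]) (\<lambda>i. monom (v $ i) 1) f
      = (\<Sum>t\<in>Poly_Mapping.keys f. monom (Poly_Mapping.lookup f t *
          (\<Prod>i\<in>UNIV. (v $ i) ^ Poly_Mapping.lookup t i)) d)"
    unfolding eval_hom_def by (rule sum.cong) (simp_all only: p, simp_all add: smult_monom)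
  also have "\<dots> = monom (eval3 f v) d"
    by (rule poly_eqI) (simp add: eval3_def coeff_sum)
  finally show ?thesis .
qed

lemma lookup_lin: "Poly_Mapping.lookup (lin w) t =
    (\<Sum>i\<in>UNIV. w $ i when Poly_Mapping.single i 1 = t)"
  by (simp add: lin_def Const_def Var_def mult_single lookup_sum lookup_single)

lemma sum_exponents_single: "(\<Sum>j\<in>UNIV. Poly_Mapping.lookup (Poly_Mapping.single (i::3) (1::nat)) j) = 1"
  by (simp add: lookup_single when_def)

lemma homogeneous_lin: "homogeneous 1 (lin w)"
  unfolding homogeneous_def
proof
  fix t assume "t \<in> Poly_Mapping.keys (lin w)"
  then have "(\<Sum>i\<in>UNIV. w $ i when Poly_Mapping.single i 1 = t) \<noteq> 0"
    by (simp add: in_keys_iff lookup_lin)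
  then obtain i where "Poly_Mapping.single i 1 = t"
    by (elim sum.not_neutral_contains_not_neutral) auto
  then show "(\<Sum>i\<in>UNIV. Poly_Mapping.lookup t i) = 1" using sum_exponents_single[of i] by simp
qed

lemma homogeneous_1_imp_lin:
  assumes "homogeneous 1 l"
  shows "\<exists>w. l = lin w"
proof
  let ?w = "\<chi> i. Poly_Mapping.lookup l (Poly_Mapping.single i 1)"
  have e: "\<exists>i. t = Poly_Mapping.single i 1" if "(\<Sum>i\<in>UNIV. Poly_Mapping.lookup t i) = 1"
    for t :: "3 \<Rightarrow>\<^sub>0 nat"
  proof -
    from iffD1[OF sum_eq_1_iff that] obtain i where i: "Poly_Mapping.lookup t i = 1"
        "\<And>j. j \<noteq> i \<Longrightarrow> Poly_Mapping.lookup t j = 0"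
      by auto
    then have "t = Poly_Mapping.single i 1"
      by (intro poly_mapping_eqI) (auto simp: lookup_single when_def)
    then show ?thesis ..
  qed
  show "l = lin ?w"
  proof (rule poly_mapping_eqI)
    fix t
    show "Poly_Mapping.lookup l t = Poly_Mapping.lookup (lin ?w) t"
    proof (cases "\<exists>i. t = Poly_Mapping.single i 1")
      case True
      then obtain i where t: "t = Poly_Mapping.single i 1" ..
      have "(Poly_Mapping.single j 1 = t) = (j = i)" for j
        unfolding t by (metis lookup_single_eq lookup_single_not_eq zero_neq_one)
      then show ?thesis by (simp add: lookup_lin when_def t del: One_nat_def)
    next
      case False
      then have "t \<notin> Poly_Mapping.keys l" using assms e by (auto simp: homogeneous_def)
      then show ?thesis using False by (auto simp: in_keys_iff lookup_lin when_def intro!: sum.neutral)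
    qed
  qed
qed

lemma lin_0: "lin 0 = 0"
  using lin_scale[of 0 0] by (simp add: Const_def)

text \<open>
  A form that vanishes at the common zero of two independent linear forms lies in the ideal that
  they generate: modulo these it is a polynomial in one further coordinate, and restricting to the
  line in direction \<open>v\<close> shows that this polynomial is zero.
\<close>

lemma point_ideal_frame:
  assumes fr: "frame a b c" and v: "v \<noteq> 0" and a: "eval3 (lin a) v = 0" and b: "eval3 (lin b) v = 0"
  shows "point_ideal (abs_proj_plane v) = ideal_gen {lin a, lin b}"
proof
  have "{lin a, lin b} \<subseteq> {f. (\<exists>d. homogeneous d f) \<and> vanishes_at f (abs_proj_plane v)}"
    using a b vanishes_at_iff[OF homogeneous_lin v] homogeneous_lin by auto
  then show "ideal_gen {lin a, lin b} \<subseteq> point_ideal (abs_proj_plane v)"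
    unfolding point_ideal_def by (rule ideal_gen_mono)
  have c: "eval3 (lin c) v \<noteq> 0" using frame_vanishing_imp_0[OF fr a b] v by blast
  let ?C = "coord_hom (lin a) (lin b) (lin c)"
  interpret C: unital_hom ?C by (rule unital_hom_coord)
  let ?\<theta> = "eval_hom (\<lambda>c. [:c:]) (\<lambda>i. monom (v $ i) 1)"
  interpret \<theta>: unital_hom ?\<theta> by (rule unital_hom_eval[OF unital_hom_const])
  have \<theta>_lin: "?\<theta> (lin w) = monom (eval3 (lin w) v) 1" for w
    by (rule eval_hom_homogeneous[OF homogeneous_lin])
  show "point_ideal (abs_proj_plane v) \<subseteq> ideal_gen {lin a, lin b}"
    unfolding point_ideal_def
  proof (rule ideal_gen_least, safe)
    fix f d assume hom: "homogeneous d f" and "vanishes_at f (abs_proj_plane v)"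
    then have ev: "eval3 f v = 0" using vanishes_at_iff[OF hom v] by simp
    \<comment> \<open>Write \<open>f\<close> as a polynomial in the frame and split off the part \<open>q\<close> in the last coordinate alone.\<close>
    obtain P where P: "?C P = f" using frame_iso[OF fr] by metis
    obtain p P' where P': "P = pCons p P'" by (cases P)
    obtain q p' where p': "p = pCons q p'" by (cases p)
    have "P = [:0, 1:] * P' + [:[:0, 1:]:] * [:p':] + [:[:q:]:]" by (simp add: P' p')
    then have f: "f = lin a * ?C P' + lin b * ?C [:p':] + extend_hom Const (lin c) q"
      using P by (simp only: C.hom_add C.hom_mult coord_hom_vars coord_hom_const2)
    have "unital_hom (\<lambda>q. ?\<theta> (extend_hom Const (lin c) q))"
      by (intro unital_hom_compose[OF \<theta>.unital_hom_axioms] unital_hom_extend unital_hom_Const)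
    moreover have "unital_hom (\<lambda>q. pcompose q (monom (eval3 (lin c) v) 1))"
      by unfold_locales (auto simp: pcompose_add pcompose_mult pcompose_1)
    ultimately have "?\<theta> (extend_hom Const (lin c) q) = pcompose q (monom (eval3 (lin c) v) 1)"
      by (rule unital_hom_poly_eqI)
        (simp_all add: extend_hom_const[OF unital_hom_Const] extend_hom_var[OF unital_hom_Const]
          eval_hom_Const[OF unital_hom_const] \<theta>_lin pcompose_pCons del: One_nat_def)
    moreover have "?\<theta> f = 0" using eval_hom_homogeneous[OF hom, of v] ev by simp
    ultimately have "pcompose q (monom (eval3 (lin c) v) 1) = 0"
      unfolding f by (simp add: \<theta>_lin a b del: One_nat_def)
    then have "q = 0"
      by (rule pcompose_eq_0) (use c in \<open>simp add: degree_monom_eq\<close>)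
    then have "f = ?C P' * lin a + ?C [:p':] * lin b"
      using f by (simp add: extend_hom_0[OF unital_hom_Const] mult.commute)
    then show "f \<in> ideal_gen {lin a, lin b}"
      by (simp add: ideal_gen_add ideal_gen_mult ideal_gen_base)
  qed
qed

lemma frame_comb:
  assumes "frame u v w" "b \<noteq> 0"
  shows "frame u (b *s v + c *s w) w"
proof -
  let ?d = "u $ 1 * (v $ 2 * w $ 3 - v $ 3 * w $ 2) - u $ 2 * (v $ 1 * w $ 3 - v $ 3 * w $ 1)
     + u $ 3 * (v $ 1 * w $ 2 - v $ 2 * w $ 1)"
  have "b * ?d \<noteq> 0" using assms by (simp add: frame_iff)
  also have "b * ?d = u $ 1 * ((b *s v + c *s w) $ 2 * w $ 3 - (b *s v + c *s w) $ 3 * w $ 2)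
     - u $ 2 * ((b *s v + c *s w) $ 1 * w $ 3 - (b *s v + c *s w) $ 3 * w $ 1)
     + u $ 3 * ((b *s v + c *s w) $ 1 * w $ 2 - (b *s v + c *s w) $ 2 * w $ 1)"
    by (simp add: algebra_simps)
  finally show ?thesis by (simp add: frame_iff)
qed

lemma eval3_lin_comb: "eval3 (lin (s *s u + t *s v)) p = s * eval3 (lin u) p + t * eval3 (lin v) p"
  by (simp add: eval3_lin_explicit algebra_simps)

lemma eval3_lin_point_comb: "eval3 (lin w) (s *s p - t *s q) = s * eval3 (lin w) p - t * eval3 (lin w) q"
  by (simp add: eval3_lin_explicit algebra_simps)

text \<open>
  If \<open>v\<^sub>k \<noteq> 0\<close>, then two independent linear forms vanishing at \<open>v\<close> can be written down, and their determinant
  with any third form \<open>z\<close> is, up to sign, \<open>v\<^sub>k\<close> times the value of \<open>z\<close> at \<open>v\<close>.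
\<close>

lemma frame_through_point:
  assumes "v \<noteq> 0" "eval3 (lin z) v \<noteq> (0::'a::field)"
  obtains x y where "frame z y x" "eval3 (lin x) v = 0" "eval3 (lin y) v = 0"
proof -
  have ev: "eval3 (lin z) v = z $ 1 * v $ 1 + z $ 2 * v $ 2 + z $ 3 * v $ 3"
    by (rule eval3_lin_explicit)
  have *: thesis if "v $ k \<noteq> 0"
    "eval3 (lin x) v = 0" "eval3 (lin y) v = 0"
    "z $ 1 * (y $ 2 * x $ 3 - y $ 3 * x $ 2) - z $ 2 * (y $ 1 * x $ 3 - y $ 3 * x $ 1)
     + z $ 3 * (y $ 1 * x $ 2 - y $ 2 * x $ 1) = v $ k * eval3 (lin z) v \<or>
     z $ 1 * (y $ 2 * x $ 3 - y $ 3 * x $ 2) - z $ 2 * (y $ 1 * x $ 3 - y $ 3 * x $ 1)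
     + z $ 3 * (y $ 1 * x $ 2 - y $ 2 * x $ 1) = - (v $ k * eval3 (lin z) v)" for k x y
  proof (rule \<open>\<And>y x. frame z y x \<Longrightarrow> eval3 (lin x) v = 0 \<Longrightarrow> eval3 (lin y) v = 0 \<Longrightarrow> thesis\<close>)
    have "v $ k * eval3 (lin z) v \<noteq> 0" using that(1) assms(2) by simp
    with that(4) show "frame z y x" unfolding frame_iff by (metis neg_equal_0_iff_equal)
  qed (use that in auto)
  from assms(1) have "v $ 1 \<noteq> 0 \<or> v $ 2 \<noteq> 0 \<or> v $ 3 \<noteq> 0" by (auto simp: vec_eq_iff forall_3)
  then consider "v $ 1 \<noteq> 0" | "v $ 2 \<noteq> 0" | "v $ 3 \<noteq> 0" by blast
  then show thesis
  proof cases
    case 1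
    then show thesis
      by (rule *[of 1 "vector [- v $ 2, v $ 1, 0]" "vector [- v $ 3, 0, v $ 1]"])
        (simp_all add: eval3_lin_explicit algebra_simps)
  next
    case 2
    then show thesis
      by (rule *[of 2 "vector [v $ 2, - v $ 1, 0]" "vector [0, - v $ 3, v $ 2]"])
        (simp_all add: eval3_lin_explicit algebra_simps)
  next
    case 3
    then show thesis
      by (rule *[of 3 "vector [v $ 3, 0, - v $ 1]" "vector [0, v $ 3, - v $ 2]"])
        (simp_all add: eval3_lin_explicit algebra_simps)
  qed
qed

text \<open>Two linear forms that cannot be completed to a frame are proportional.\<close>

lemma frame_complete:
  assumes "y \<noteq> 0" "\<And>z. \<not> frame z y x"
  obtains k where "x = k *s (y :: 'a::field ^ 3)"
proof -
  have c: "y $ 2 * x $ 3 = y $ 3 * x $ 2" "y $ 1 * x $ 3 = y $ 3 * x $ 1" "y $ 1 * x $ 2 = y $ 2 * x $ 1"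
    using assms(2)[of "vector [1, 0, 0]"] assms(2)[of "vector [0, 1, 0]"]
      assms(2)[of "vector [0, 0, 1]"] by (simp_all add: frame_iff)
  have "\<exists>i. y $ i \<noteq> 0" using assms(1) by (auto simp: vec_eq_iff)
  then obtain i where i: "y $ i \<noteq> 0" ..
  have "y $ i * x $ j = x $ i * y $ j" for j
    using exhaust_3[of i] exhaust_3[of j] c by (auto simp: mult.commute)
  then have "x = (x $ i / y $ i) *s y"
    using i by (simp add: vec_eq_iff field_simps)
  then show ?thesis by (rule that)
qed

lemma lineE:
  assumes "line L"
  obtains w where "w \<noteq> 0" "\<And>v. v \<noteq> 0 \<Longrightarrow> abs_proj_plane v \<in> L \<longleftrightarrow> eval3 (lin w) v = 0"
proof -
  from assms obtain l where l: "homogeneous 1 l" "l \<noteq> 0" "L = {q. vanishes_at l q}"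
    by (auto simp: line_def)
  then obtain w where w: "l = lin w" using homogeneous_1_imp_lin by blast
  have "w \<noteq> 0" using l w lin_0 by auto
  then show ?thesis by (rule that) (use l w vanishes_at_iff[OF homogeneous_lin] in auto)
qed

section \<open>Symbolic powers in coordinates\<close>

text \<open>
  In both configurations, the symbolic power is described by a frame \<open>x, y, z\<close> of linear forms.
  For almost collinear points, \<open>z\<close> defines the line, \<open>x\<close> and \<open>y\<close> vanish at the point off it, and
  \<open>b\<^sub>i y + c\<^sub>i x\<close> defines the line joining this point to the \<open>i\<close>-th collinear one.
\<close>

lemma almost_collinear_coordinates:
  fixes Q :: "'a::field proj_plane set"
  assumes "almost_collinear n Q"
  obtains x y z :: "'a ^ 3" and b c :: "nat \<Rightarrow> 'a" where
    "frame z y x"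
    "\<And>i. i \<in> {1..n} \<Longrightarrow> b i \<noteq> 0 \<or> c i \<noteq> 0"
    "\<And>i j. i \<in> {1..n} \<Longrightarrow> j \<in> {1..n} \<Longrightarrow> i \<noteq> j \<Longrightarrow> b i * c j \<noteq> b j * c i"
    "\<And>m. symbolic_power Q m = ideal_power (ideal_gen {lin x, lin y}) m \<inter>
       (\<Inter>i\<in>{1..n}. ideal_power (ideal_gen {lin z, Const (b i) * lin y + Const (c i) * lin x}) m)"
proof -
  from assms obtain p L where Q: "Q = p ` {0..n}" and inj: "inj_on p {0..n}" and L: "line L"
    and on: "\<And>i. i \<in> {1..n} \<Longrightarrow> p i \<in> L" and off: "p 0 \<notin> L"
    unfolding almost_collinear_def by blast
  define v where "v i = rep_proj_plane (p i)" for i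
  have v: "v i \<noteq> 0" "abs_proj_plane (v i) = p i" for i
    by (simp_all add: v_def rep_proj_plane_nonzero abs_rep_proj_plane)
  obtain z where z: "\<And>u. u \<noteq> 0 \<Longrightarrow> abs_proj_plane u \<in> L \<longleftrightarrow> eval3 (lin z) u = 0"
    using lineE[OF L] by metis
  have z0: "eval3 (lin z) (v 0) \<noteq> 0" using z[OF v(1)] off by (simp add: v(2))
  have zi: "eval3 (lin z) (v i) = 0" if "i \<in> {1..n}" for i
    using z[OF v(1)] on[OF that] by (simp add: v(2))
  obtain x y where fr: "frame z y x" and x0: "eval3 (lin x) (v 0) = 0"
    and y0: "eval3 (lin y) (v 0) = 0"
    using frame_through_point[OF v(1) z0] by blast
  define b c where "b i = eval3 (lin x) (v i)" and "c i = - eval3 (lin y) (v i)" for i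
  have nz: "b i \<noteq> 0 \<or> c i \<noteq> 0" if "i \<in> {1..n}" for i
    using frame_vanishing_imp_0[OF fr zi[OF that]] v(1) by (auto simp: b_def c_def)
  have indep: "b i * c j \<noteq> b j * c i" if ij: "i \<in> {1..n}" "j \<in> {1..n}" "i \<noteq> j" for i j
  proof
    assume eq: "b i * c j = b j * c i"
    have "b i *s v j - b j *s v i = 0" "c i *s v j - c j *s v i = 0"
      by (rule frame_vanishing_imp_0[OF fr]; use eq in \<open>simp only: eval3_lin_point_comb\<close>;
          simp add: zi[OF ij(1)] zi[OF ij(2)] b_def c_def mult.commute)+
    then have "abs_proj_plane (v i) = abs_proj_plane (v j)"
      using nz[OF ij(1)] abs_proj_plane_eqI[OF v(1)[of i] v(1)[of j]] by blast
    then show False using inj ij unfolding v(2) by (auto dest: inj_onD)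
  qed
  have p0: "point_ideal (p 0) = ideal_gen {lin x, lin y}"
    using point_ideal_frame[of x y z "v 0"] frame_swap12 frame_swap23 fr v x0 y0 by metis
  have pi: "point_ideal (p i) = ideal_gen {lin z, Const (b i) * lin y + Const (c i) * lin x}"
    if i: "i \<in> {1..n}" for i
  proof -
    have "\<exists>w. frame z (b i *s y + c i *s x) w"
    proof (cases "b i = 0")
      case True
      then show ?thesis using frame_comb[OF frame_swap23[OF fr], of "c i" "b i"] nz[OF i]
        by (auto simp: add.commute)
    qed (use frame_comb[OF fr] in blast)
    then obtain w where "frame z (b i *s y + c i *s x) w" ..
    then have "point_ideal (abs_proj_plane (v i)) = ideal_gen {lin z, lin (b i *s y + c i *s x)}"
      by (rule point_ideal_frame[OF _ v(1) zi[OF i]])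
        (simp only: eval3_lin_comb, simp add: b_def c_def)
    then show ?thesis by (simp add: v(2) lin_add lin_scale)
  qed
  have "{0..n} = insert 0 {1..n}" by auto
  then have "symbolic_power Q m = ideal_power (ideal_gen {lin x, lin y}) m \<inter>
       (\<Inter>i\<in>{1..n}. ideal_power (ideal_gen {lin z, Const (b i) * lin y + Const (c i) * lin x}) m)" for m
    by (simp add: symbolic_power_def Q p0 pi)
  then show ?thesis using that fr nz indep by blast
qed

text \<open>
  For a nearly complete intersection, \<open>x\<close> and \<open>y\<close> define the two lines, and the points on them
  other than the common one are cut out by \<open>z - b\<^sub>i y\<close> and \<open>z - c\<^sub>i x\<close>.
\<close>

lemma nearly_complete_intersection_coordinates:
  fixes Q :: "'a::field proj_plane set"
  assumes "nearly_complete_intersection n Q"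
  obtains x y z :: "'a ^ 3" and b c :: "nat \<Rightarrow> 'a" where
    "frame z y x" "inj_on b {1..n}" "inj_on c {n+1..2*n}"
    "\<And>m. symbolic_power Q m = ideal_power (ideal_gen {lin x, lin y}) m \<inter>
       (\<Inter>i\<in>{1..n}. ideal_power (ideal_gen {lin x, lin z - Const (b i) * lin y}) m) \<inter>
       (\<Inter>i\<in>{n+1..2*n}. ideal_power (ideal_gen {lin y, lin z - Const (c i) * lin x}) m)"
proof -
  from assms obtain p L1 L2 where Q: "Q = p ` {0..2*n}" and inj: "inj_on p {0..2*n}"
    and L: "line L1" "line L2" "L1 \<noteq> L2" "L1 \<inter> L2 = {p 0}"
    and on1: "\<And>i. i \<in> {1..n} \<Longrightarrow> p i \<in> L1 - L2"
    and on2: "\<And>i. i \<in> {n+1..2*n} \<Longrightarrow> p i \<in> L2 - L1"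
    unfolding nearly_complete_intersection_def by blast
  define v where "v i = rep_proj_plane (p i)" for i
  have v: "v i \<noteq> 0" "abs_proj_plane (v i) = p i" for i
    by (simp_all add: v_def rep_proj_plane_nonzero abs_rep_proj_plane)
  obtain x where x: "x \<noteq> 0" "\<And>u. u \<noteq> 0 \<Longrightarrow> abs_proj_plane u \<in> L1 \<longleftrightarrow> eval3 (lin x) u = 0"
    using lineE[OF L(1)] by metis
  obtain y where y: "y \<noteq> 0" "\<And>u. u \<noteq> 0 \<Longrightarrow> abs_proj_plane u \<in> L2 \<longleftrightarrow> eval3 (lin y) u = 0"
    using lineE[OF L(2)] by metis
  have "\<exists>z. frame z y x"
  proof (rule ccontr)
    assume "\<nexists>z. frame z y x"
    then obtain k where k: "x = k *s y" using frame_complete[OF y(1)] by blast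
    with x(1) have "k \<noteq> 0" by auto
    then have "eval3 (lin x) u = 0 \<longleftrightarrow> eval3 (lin y) u = 0" for u
      unfolding k using eval3_lin_comb[of k y 0 0 u] by simp
    then have "q \<in> L1 \<longleftrightarrow> q \<in> L2" for q
      using x(2)[OF rep_proj_plane_nonzero[of q]] y(2)[OF rep_proj_plane_nonzero[of q]]
      by (simp add: abs_rep_proj_plane)
    then show False using L(3) by blast
  qed
  then obtain z where fr: "frame z y x" ..
  have x0: "eval3 (lin x) (v 0) = 0" and y0: "eval3 (lin y) (v 0) = 0"
    using L(4) x(2)[OF v(1)[of 0]] y(2)[OF v(1)[of 0]] by (auto simp: v(2))
  have 1: "eval3 (lin x) (v i) = 0" "eval3 (lin y) (v i) \<noteq> 0" if "i \<in> {1..n}" for i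
    using on1[OF that] x(2)[OF v(1)[of i]] y(2)[OF v(1)[of i]] by (auto simp: v(2))
  have 2: "eval3 (lin y) (v i) = 0" "eval3 (lin x) (v i) \<noteq> 0" if "i \<in> {n+1..2*n}" for i
    using on2[OF that] x(2)[OF v(1)[of i]] y(2)[OF v(1)[of i]] by (auto simp: v(2))
  define b c where "b i = eval3 (lin z) (v i) / eval3 (lin y) (v i)"
    and "c i = eval3 (lin z) (v i) / eval3 (lin x) (v i)" for i
  have b: "inj_on b {1..n}"
  proof (rule inj_onI)
    fix i j assume ij: "i \<in> {1..n}" "j \<in> {1..n}" and eq: "b i = b j"
    have "eval3 (lin y) (v i) *s v j - eval3 (lin y) (v j) *s v i = 0"
      using eq 1[OF ij(1)] 1[OF ij(2)]
      by (intro frame_vanishing_imp_0[OF fr]) (simp_all add: eval3_lin_point_comb b_def field_simps)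
    then have "abs_proj_plane (v i) = abs_proj_plane (v j)"
      by (rule abs_proj_plane_eqI[OF v(1)[of i] v(1)[of j] 1(2)[OF ij(1)]])
    then show "i = j" using inj ij unfolding v(2) by (auto dest: inj_onD)
  qed
  have c: "inj_on c {n+1..2*n}"
  proof (rule inj_onI)
    fix i j assume ij: "i \<in> {n+1..2*n}" "j \<in> {n+1..2*n}" and eq: "c i = c j"
    have "eval3 (lin x) (v i) *s v j - eval3 (lin x) (v j) *s v i = 0"
      using eq 2[OF ij(1)] 2[OF ij(2)]
      by (intro frame_vanishing_imp_0[OF fr]) (simp_all add: eval3_lin_point_comb c_def field_simps)
    then have "abs_proj_plane (v i) = abs_proj_plane (v j)"
      by (rule abs_proj_plane_eqI[OF v(1)[of i] v(1)[of j] 2(2)[OF ij(1)]])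
    then show "i = j" using inj ij unfolding v(2) by (auto dest: inj_onD)
  qed
  have fr': "frame x y z" "frame x z y" "frame y z x"
    using frame_swap12 frame_swap23 fr by metis+
  have lin_diff: "lin (1 *s z + (- k) *s w) = lin z - Const k * lin w" for k w
    unfolding lin_add lin_scale unital_hom.hom_minus[OF unital_hom_Const]
      unital_hom.hom_1[OF unital_hom_Const] by simp
  have p0: "point_ideal (p 0) = ideal_gen {lin x, lin y}"
    using point_ideal_frame[OF fr'(1) v(1)[of 0] x0 y0] by (simp add: v(2))
  have p1: "point_ideal (p i) = ideal_gen {lin x, lin z - Const (b i) * lin y}" if i: "i \<in> {1..n}" for i
    unfolding v(2)[symmetric] lin_diff[symmetric]
    by (rule point_ideal_frame[OF frame_comb[OF fr'(2)] v(1) 1(1)[OF i]])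
      (use 1(2)[OF i] in \<open>simp, simp only: eval3_lin_comb, simp add: b_def\<close>)
  have p2: "point_ideal (p i) = ideal_gen {lin y, lin z - Const (c i) * lin x}" if i: "i \<in> {n+1..2*n}" for i
    unfolding v(2)[symmetric] lin_diff[symmetric]
    by (rule point_ideal_frame[OF frame_comb[OF fr'(3)] v(1) 2(1)[OF i]])
      (use 2(2)[OF i] in \<open>simp, simp only: eval3_lin_comb, simp add: c_def\<close>)
  have "{0..2*n} = insert 0 ({1..n} \<union> {n+1..2*n})" by auto
  then have "symbolic_power Q m = ideal_power (ideal_gen {lin x, lin y}) m \<inter>
       (\<Inter>i\<in>{1..n}. ideal_power (ideal_gen {lin x, lin z - Const (b i) * lin y}) m) \<inter>
       (\<Inter>i\<in>{n+1..2*n}. ideal_power (ideal_gen {lin y, lin z - Const (c i) * lin x}) m)" for m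
    by (simp add: symbolic_power_def Q p0 p1 p2 INT_Un Int_assoc)
  then show ?thesis using that fr b c by blast
qed

section \<open>Tools for comparing ideals\<close>

lemma ideal_gen_scaled:
  assumes "h \<in> ideal_gen S" "\<And>s. s \<in> S \<Longrightarrow> a * s \<in> ideal_gen T"
  shows "a * h \<in> ideal_gen T"
  using assms(1)
proof (induction rule: ideal_gen_induct)
  case zero
  then show ?case by (simp add: ideal_gen_0)
next
  case (step r s h)
  then have "r * (a * s) + a * h \<in> ideal_gen T"
    by (simp add: assms(2) ideal_gen_add ideal_gen_mult)
  then show ?case by (simp add: algebra_simps)
qed

lemma ideal_power_scaled:
  assumes "\<And>a. a \<in> J \<Longrightarrow> z * a \<in> J'" "h \<in> ideal_power J s"
  shows "z ^ s * h \<in> ideal_power J' s"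
  using assms(2)
proof (induction s arbitrary: h)
  case (Suc s)
  have "z ^ Suc s * h \<in> ideal_gen {a * b | a b. a \<in> J' \<and> b \<in> ideal_power J' s}"
  proof (rule ideal_gen_scaled)
    show "h \<in> ideal_gen {a * b | a b. a \<in> J \<and> b \<in> ideal_power J s}" using Suc.prems by simp
    fix y assume "y \<in> {a * b | a b. a \<in> J \<and> b \<in> ideal_power J s}"
    then obtain a b where y: "y = a * b" "a \<in> J" "b \<in> ideal_power J s" by blast
    have "(z * a) * (z ^ s * b) \<in> ideal_gen {a * b | a b. a \<in> J' \<and> b \<in> ideal_power J' s}"
      using assms(1)[OF y(2)] Suc.IH[OF y(3)] by (intro ideal_gen_base) blast
    then show "z ^ Suc s * y \<in> ideal_gen {a * b | a b. a \<in> J' \<and> b \<in> ideal_power J' s}"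
      by (simp add: y(1) mult.assoc mult.left_commute)
  qed
  then show ?case by simp
qed simp

lemma monomial_mem_ideal_power:
  assumes "a \<in> J" "b \<in> J"
  shows "a ^ i * b ^ j \<in> ideal_power J (i + j)"
  using assms by (intro ideal_power_mult_mem power_mem_ideal_power')

lemma coeff_mem_ideal_gen:
  assumes "p \<in> ideal_gen {[:a:] ^ i * [:b:] ^ j | i j. m \<le> i + j}"
  shows "coeff p t \<in> ideal_gen {a ^ i * b ^ j | i j. m \<le> i + j}"
  using assms
proof (induction rule: ideal_gen_induct)
  case zero
  then show ?case by (simp add: ideal_gen_0)
next
  case (step r s p)
  from step(1) obtain i j where "s = [:a:] ^ i * [:b:] ^ j" and le: "m \<le> i + j" by blast
  then have s: "s = [:a ^ i * b ^ j:]" by (simp add: poly_const_pow mult.commute)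
  have "coeff (r * s + p) t = coeff r t * (a ^ i * b ^ j) + coeff p t"
    by (simp add: s mult.commute)
  moreover have "coeff r t * (a ^ i * b ^ j) \<in> ideal_gen {a ^ i * b ^ j | i j. m \<le> i + j}"
    using le by (intro ideal_gen_mult pair_gen_base)
  ultimately show ?case using step.IH by (simp only: ideal_gen_add)
qed

lemma points_ideal_eq_symbolic_power: "points_ideal Q = symbolic_power Q 1"
  unfolding points_ideal_def symbolic_power_def point_ideal_def by (simp only: ideal_power_1)

text \<open>The product of the \<open>d\<close>-th power of the variable and a polynomial with nonzero constant
  coefficient has order exactly \<open>d\<close>.\<close>

lemma var_power_dvd_imp:
  fixes c :: "'t::idom poly"
  assumes "[:0, 1:] ^ k dvd [:0, 1:] ^ d * c" "d < k"
  shows "coeff c 0 = 0"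
proof -
  have "[:0, 1:] ^ d * [:0, 1:] dvd ([:0, 1:] ^ k :: 't poly)"
    using le_imp_power_dvd[of "Suc d" k "[:0, 1:] :: 't poly"] assms(2) by (simp add: mult.commute)
  then have "[:0, 1:] ^ d * [:0, 1:] dvd [:0, 1:] ^ d * c" using assms(1) by (rule dvd_trans)
  then have "[:0, 1:] dvd c" by (simp only: dvd_mult_cancel_left) simp
  then show ?thesis by (simp add: dvd_iff_poly_eq_0 poly_0_coeff_0)
qed

section \<open>Almost collinear points\<close>

text \<open>
  A linear form has order exactly one at the origin of the affine plane, so it may be cancelled
  from membership in a power of the ideal of the origin.
\<close>

lemma lform_cancel:
  fixes b c :: "'a::field"
  assumes bc: "b \<noteq> 0 \<or> c \<noteq> 0"
    and mem: "lform b c * h \<in> ideal_gen {[:0, 1:] ^ i * [:[:0, 1:]:] ^ j | i j. Suc s \<le> i + j}"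
  shows "h \<in> ideal_gen {[:0, 1:] ^ i * [:[:0, 1:]:] ^ j | i j. s \<le> i + j}"
  unfolding mem_pair_power_poly_iff
proof
  define x where "x = ([:0, 1:] :: 'a poly)"
  have dvd: "x ^ (Suc s - j) dvd coeff (lform b c * h) j" for j
    using mem unfolding mem_pair_power_poly_iff x_def by blast
  fix j
  have "x ^ (s - j) dvd coeff h j"
  proof (cases "j \<le> s")
    case le: True
    show ?thesis
    proof (cases "b = 0")
      case True
      have "coeff (lform b c * h) j = smult c (x * coeff h j)"
        using True by (simp add: lform_def x_def)
      then have "x * x ^ (s - j) dvd x * coeff h j"
        using dvd[of j] le True bc by (simp add: dvd_smult_iff Suc_diff_le)
      then show ?thesis by (simp only: dvd_mult_cancel_left) (simp add: x_def)
    next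
      case False
      \<comment> \<open>Descending from \<open>j = s\<close>, where nothing is claimed: coefficient \<open>j + 1\<close> of the product
        involves only coefficients \<open>j\<close> and \<open>j + 1\<close> of \<open>h\<close>.\<close>
      from le show ?thesis
      proof (induction rule: inc_induct)
        case (step j)
        have "coeff (lform b c * h) (Suc j) = smult c (x * coeff h (Suc j)) + smult b (coeff h j)"
          by (simp add: lform_def x_def)
        then have "x ^ (s - j) dvd smult c (x * coeff h (Suc j)) + smult b (coeff h j)"
          using dvd[of "Suc j"] by simp
        moreover have "x ^ (s - j) = x * x ^ (s - Suc j)"
          using step.hyps by (simp flip: power_Suc add: Suc_diff_Suc)
        then have "x ^ (s - j) dvd smult c (x * coeff h (Suc j))"
          using step.IH by (simp only:) (intro dvd_smult mult_dvd_mono dvd_refl)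
        ultimately have "x ^ (s - j) dvd smult b (coeff h j)" by (simp add: dvd_add_right_iff)
        then show ?case using False by (simp add: dvd_smult_iff)
      qed simp
    qed
  qed simp
  then show "[:0, 1:] ^ (s - j) dvd coeff h j" by (simp only: x_def)
qed

lemma prod_lform_cancel:
  fixes b c :: "'i \<Rightarrow> 'a::field"
  assumes "finite S" "\<And>i. i \<in> S \<Longrightarrow> b i \<noteq> 0 \<or> c i \<noteq> 0"
    and "(\<Prod>i\<in>S. lform (b i) (c i)) * h
      \<in> ideal_gen {[:0, 1:] ^ i * [:[:0, 1:]:] ^ j | i j. card S + s \<le> i + j}"
  shows "h \<in> ideal_gen {[:0, 1:] ^ i * [:[:0, 1:]:] ^ j | i j. s \<le> i + j}"
  using assms
proof (induction S rule: finite_induct)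
  case (insert i S)
  have "lform (b i) (c i) * ((\<Prod>i\<in>S. lform (b i) (c i)) * h)
      \<in> ideal_gen {[:0, 1:] ^ i * [:[:0, 1:]:] ^ j | i j. Suc (card S + s) \<le> i + j}"
    using insert.prems(2) insert.hyps by (simp add: mult.assoc)
  then have "(\<Prod>i\<in>S. lform (b i) (c i)) * h
      \<in> ideal_gen {[:0, 1:] ^ i * [:[:0, 1:]:] ^ j | i j. card S + s \<le> i + j}"
    by (rule lform_cancel[rotated]) (rule insert.prems(1), simp)
  then show ?case using insert.IH insert.prems(1) by blast
qed simp

lemma prod_lform_power_cancel:
  fixes b c :: "'i \<Rightarrow> 'a::field"
  assumes "finite S" "\<And>i. i \<in> S \<Longrightarrow> b i \<noteq> 0 \<or> c i \<noteq> 0"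
    and "(\<Prod>i\<in>S. lform (b i) (c i)) ^ k * h
      \<in> ideal_gen {[:0, 1:] ^ i * [:[:0, 1:]:] ^ j | i j. m \<le> i + j}"
  shows "h \<in> ideal_gen {[:0, 1:] ^ i * [:[:0, 1:]:] ^ j | i j. m - card S * k \<le> i + j}"
  using assms(3)
proof (induction k arbitrary: m)
  case (Suc k)
  let ?M = "\<lambda>m. {[:0, 1:] ^ i * [:[:0, 1:]:] ^ j | i j. m \<le> i + j} :: 'a poly poly set"
  let ?F = "\<Prod>i\<in>S. lform (b i) (c i)"
  have mono: "ideal_gen (?M m) \<subseteq> ideal_gen (?M m')" if "m' \<le> m" for m m'
    using that by (intro ideal_gen_mono) force
  show ?case
  proof (cases "card S \<le> m")
    case True
    have "?F * (?F ^ k * h) \<in> ideal_gen (?M (card S + (m - card S)))"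
      using Suc.prems True by (simp add: mult.assoc)
    from prod_lform_cancel[OF assms(1) _ this] assms(2)
    have "?F ^ k * h \<in> ideal_gen (?M (m - card S))" by blast
    from Suc.IH[OF this] show ?thesis by (simp add: diff_diff_left add.commute)
  next
    case False
    have "1 \<in> ideal_gen (?M 0)" using pair_gen_base[of 0 0 0] by simp
    then have "h \<in> ideal_gen (?M 0)" using ideal_gen_mult[of 1 _ h] by simp
    moreover have "m - card S * Suc k = 0" using False by simp
    ultimately show ?thesis by simp
  qed
qed simp

lemma almost_collinear_symbolic_power:
  fixes x y z :: "'a::field ^ 3" and b c :: "nat \<Rightarrow> 'a"
  assumes fr: "frame z y x"
    and nz: "\<And>i. i \<in> {1..n} \<Longrightarrow> b i \<noteq> 0 \<or> c i \<noteq> 0"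
    and indep: "\<And>i j. i \<in> {1..n} \<Longrightarrow> j \<in> {1..n} \<Longrightarrow> i \<noteq> j \<Longrightarrow> b i * c j \<noteq> b j * c i"
  defines "l \<equiv> \<lambda>i. Const (b i) * lin y + Const (c i) * lin x"
  defines "F \<equiv> \<Prod>i\<in>{1..n}. l i"
  shows "ideal_power (ideal_gen {lin x, lin y}) m \<inter>
      (\<Inter>i\<in>{1..n}. ideal_power (ideal_gen {lin z, l i}) m) =
    ideal_gen {lin z ^ t * F ^ k * (lin x ^ i * lin y ^ j) | t k i j. m \<le> t + k \<and> m \<le> n * k + i + j}"
    (is "?S = ideal_gen ?G")
proof
  let ?J = "ideal_gen {lin x, lin y}"
  have F_mem: "F \<in> ideal_power ?J n"
    using prod_mem_ideal_power[of "{1..n}" l ?J]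
    by (simp add: F_def l_def ideal_gen_add ideal_gen_mult ideal_gen_base)
  show "ideal_gen ?G \<subseteq> ?S"
  proof
    fix f assume f: "f \<in> ideal_gen ?G"
    have 1: "?G \<subseteq> ideal_power ?J m"
    proof safe
      fix t k i j assume le: "m \<le> t + k" "m \<le> n * k + i + j"
      have "F ^ k * (lin x ^ i * lin y ^ j) \<in> ideal_power ?J (n * k + (i + j))"
        by (intro ideal_power_mult_mem power_mem_ideal_power F_mem monomial_mem_ideal_power
            ideal_gen_base) auto
      then have "lin z ^ t * (F ^ k * (lin x ^ i * lin y ^ j)) \<in> ideal_power ?J (n * k + (i + j))"
        by (rule ideal_power_scale_mem)
      then show "lin z ^ t * F ^ k * (lin x ^ i * lin y ^ j) \<in> ideal_power ?J m"
        using ideal_power_antimono[of m "n * k + (i + j)" ?J] le by (auto simp: mult.assoc)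
    qed
    have 2: "?G \<subseteq> ideal_power (ideal_gen {lin z, l q}) m" if q: "q \<in> {1..n}" for q
    proof safe
      fix t k i j assume le: "m \<le> t + k" "m \<le> n * k + i + j"
      have "l q dvd F" unfolding F_def using q by (intro dvd_prodI) auto
      then obtain F' where F': "F = l q * F'" by (elim dvdE)
      have "lin z ^ t * l q ^ k \<in> ideal_power (ideal_gen {lin z, l q}) (t + k)"
        by (intro monomial_mem_ideal_power ideal_gen_base) auto
      then have "(F' ^ k * (lin x ^ i * lin y ^ j)) * (lin z ^ t * l q ^ k)
          \<in> ideal_power (ideal_gen {lin z, l q}) (t + k)"
        by (rule ideal_power_scale_mem)
      also have "(F' ^ k * (lin x ^ i * lin y ^ j)) * (lin z ^ t * l q ^ k)
          = lin z ^ t * F ^ k * (lin x ^ i * lin y ^ j)"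
        by (simp add: F' power_mult_distrib mult_ac)
      finally show "lin z ^ t * F ^ k * (lin x ^ i * lin y ^ j)
          \<in> ideal_power (ideal_gen {lin z, l q}) m"
        using ideal_power_antimono[OF le(1)] by blast
    qed
    show "f \<in> ?S"
      using subsetD[OF ideal_gen_subset_ideal_power[OF 1] f]
        subsetD[OF ideal_gen_subset_ideal_power[OF 2] f] by (intro IntI INT_I)
  qed
  show "?S \<subseteq> ideal_gen ?G"
  proof
    fix f assume f: "f \<in> ?S"
    let ?C = "coord_hom (lin z) (lin y) (lin x)"
    interpret C: unital_hom ?C by (rule unital_hom_coord)
    obtain \<psi> where \<psi>: "unital_hom \<psi>" "\<And>f. ?C (\<psi> f) = f" "\<And>p. \<psi> (?C p) = p"
      using frame_iso[OF fr] by metis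
    interpret \<psi>: unital_hom \<psi> by (rule \<psi>)
    have \<psi>_vars: "\<psi> (lin z) = [:0, 1:]" "\<psi> (lin y) = [:[:0, 1:]:]" "\<psi> (lin x) = [:[:[:0, 1:]:]:]"
      using \<psi>(3)[of "[:0, 1:]"] \<psi>(3)[of "[:[:0, 1:]:]"] \<psi>(3)[of "[:[:[:0, 1:]:]:]"]
      by (simp_all only: coord_hom_vars)
    define F0 where "F0 = (\<Prod>i\<in>{1..n}. lform (b i) (c i))"
    have C_F0: "?C [:F0:] = F"
    proof -
      interpret k: unital_hom "\<lambda>c::'a poly poly. [:c:]" by (rule unital_hom_const)
      have "[:lform (b i) (c i):] = [:[:[:b i:]:]:] * [:[:0, 1:]:] + [:[:[:c i:]:]:] * [:[:[:0, 1:]:]:]"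
        for i by (simp add: lform_def)
      then have "?C [:lform (b i) (c i):] = l i" for i
        by (simp only: C.hom_add C.hom_mult coord_hom_const3 coord_hom_vars l_def)
      then show ?thesis by (simp add: F0_def F_def k.hom_prod)
    qed
    have "f \<in> ideal_gen {lin z ^ s * F ^ t | s t. m \<le> s + t}"
      unfolding F_def
      by (rule inter_pair_powers[OF fr _ _ nz indep])
        (use f in \<open>auto simp: l_def simp flip: ideal_power_pair\<close>)
    from \<psi>.hom_pair_power[OF this] have "\<psi> f \<in> ideal_gen {[:0, 1:] ^ s * [:F0:] ^ t | s t. m \<le> s + t}"
      using \<psi>(3)[of "[:F0:]"] by (simp only: C_F0 \<psi>_vars)
    then have dvd: "F0 ^ (m - t) dvd coeff (\<psi> f) t" for t
      by (simp only: mem_pair_power_poly_iff)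
    have "f \<in> ideal_gen {lin y ^ s * lin x ^ t | s t. m \<le> s + t}"
      using f by (simp add: insert_commute flip: ideal_power_pair)
    from \<psi>.hom_pair_power[OF this]
    have mem: "coeff (\<psi> f) t \<in> ideal_gen {[:0, 1:] ^ i * [:[:0, 1:]:] ^ j | i j. m \<le> i + j}" for t
      unfolding \<psi>_vars by (rule coeff_mem_ideal_gen)
    have "?C (monom (coeff (\<psi> f) t) t) \<in> ideal_gen ?G" for t
    proof -
      obtain h where h: "coeff (\<psi> f) t = F0 ^ (m - t) * h" using dvd by (meson dvdE)
      have "h \<in> ideal_gen {[:0, 1:] ^ i * [:[:0, 1:]:] ^ j | i j. m - card {1..n} * (m - t) \<le> i + j}"
        using mem[of t] nz unfolding h F0_def by (intro prod_lform_power_cancel) auto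
      then have "[:h:] \<in> ideal_gen ((\<lambda>c. [:c:]) `
          {[:0, 1:] ^ i * [:[:0, 1:]:] ^ j | i j. m - card {1..n} * (m - t) \<le> i + j})"
        by (rule unital_hom.hom_ideal_gen[OF unital_hom_const])
      then have "[:h:] \<in> ideal_gen
          {[:[:0, 1:]:] ^ i * [:[:[:0, 1:]:]:] ^ j | i j. m - n * (m - t) \<le> i + j}"
        by (rule subsetD[OF ideal_gen_mono, rotated]) (auto simp: poly_const_pow)
      from C.hom_pair_power[OF this]
      have h_mem: "?C [:h:] \<in> ideal_gen {lin y ^ i * lin x ^ j | i j. m - n * (m - t) \<le> i + j}"
        by (simp only: coord_hom_vars)
      have "(lin z ^ t * F ^ (m - t)) * ?C [:h:] \<in> ideal_gen ?G"
      proof (rule ideal_gen_scaled[OF h_mem])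
        fix s assume "s \<in> {lin y ^ i * lin x ^ j | i j. m - n * (m - t) \<le> i + j}"
        then obtain i j where s: "s = lin y ^ i * lin x ^ j" "m - n * (m - t) \<le> i + j" by blast
        then have "m \<le> t + (m - t) \<and> m \<le> n * (m - t) + j + i" by linarith
        then have "lin z ^ t * F ^ (m - t) * (lin x ^ j * lin y ^ i) \<in> ?G" by blast
        then show "(lin z ^ t * F ^ (m - t)) * s \<in> ideal_gen ?G"
          unfolding s(1) mult.commute[of "lin y ^ i"] by (rule ideal_gen_base)
      qed
      moreover have "monom (coeff (\<psi> f) t) t = [:0, 1:] ^ t * [:F0:] ^ (m - t) * [:h:]"
        by (simp add: h monom_altdef poly_const_pow mult.commute)
      ultimately show ?thesis
        by (simp only: C.hom_mult C.hom_power coord_hom_vars C_F0)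
    qed
    then have "?C (\<Sum>t\<le>degree (\<psi> f). monom (coeff (\<psi> f) t) t) \<in> ideal_gen ?G"
      unfolding C.hom_sum by (intro ideal_gen_sum)
    then show "f \<in> ideal_gen ?G" by (simp only: poly_as_sum_of_monoms \<psi>)
  qed
qed

text \<open>
  The next two lemmas compare the exponents of the generators \<open>z\<^sup>t F\<^sup>k x\<^sup>i y\<^sup>j\<close> of a symbolic power with
  those of an ordinary power; \<open>e\<close> stands for \<open>i + j\<close>. The inequality
  \<open>n\<^sup>2 m + m + n \<le> n\<^sup>2 r + n m\<close> is \<open>(n\<^sup>2 - n + 1) m \<le> n\<^sup>2 r - n\<close> without subtraction.
\<close>

lemma almost_collinear_arith_contained:
  fixes n m r t k e :: nat
  assumes "n \<ge> 2" "r > 0" and no: "\<not> n * n * m + m + n \<le> n * n * r + n * m"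
  shows "r \<le> m"
    and "t < r \<Longrightarrow> m \<le> t + k \<Longrightarrow> m \<le> n * k + e \<Longrightarrow> t \<le> n * (k - (r - t)) + e"
proof -
  show rm: "r \<le> m"
  proof (rule ccontr)
    assume "\<not> r \<le> m"
    then have "n * n * Suc m \<le> n * n * r" by (intro mult_le_mono) auto
    moreover have "1 * m \<le> n * m" "1 * n \<le> n * n" using assms(1) by (intro mult_le_mono; simp)+
    ultimately show False using no by simp
  qed
  assume t: "t < r" and k: "m \<le> t + k" and e: "m \<le> n * k + e"
  show "t \<le> n * (k - (r - t)) + e"
  proof (rule ccontr)
    assume "\<not> t \<le> n * (k - (r - t)) + e"
    moreover define k' where "k' = k - (r - t)"
    ultimately have tk: "t \<ge> n * k' + e + 1" by simp
    have kk: "k = k' + (r - t)" using k rm t by (simp add: k'_def)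
    define N M R T K' E where "N = int n" and "M = int m" and "R = int r" and "T = int t"
      and "K' = int k'" and "E = int e"
    have 1: "T \<ge> N * K' + E + 1"
      using tk unfolding N_def T_def K'_def E_def by (metis of_nat_1 of_nat_add of_nat_le_iff of_nat_mult)
    have "int m \<le> int (n * k + e)" using e by (simp only: of_nat_le_iff)
    then have 2: "M \<le> N * (K' + (R - T)) + E"
      using t unfolding kk by (simp add: N_def M_def R_def T_def K'_def E_def of_nat_diff add_diff_eq)
    have "N * (M - R) \<le> N * K'"
      using k kk t by (intro mult_left_mono) (auto simp: N_def M_def R_def K'_def)
    then have "N * (M - R) + 1 \<le> T" using 1 by (simp add: E_def)
    then have "(N - 1) * (N * (M - R) + 1) \<le> (N - 1) * T"
      using assms(1) by (intro mult_left_mono) (auto simp: N_def)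
    also have "(N - 1) * T \<le> N * R - M - 1" using 1 2 by (simp add: algebra_simps)
    finally have "N * N * M + M + N \<le> N * N * R + N * M" by (simp add: algebra_simps)
    then have "int (n * n * m + m + n) \<le> int (n * n * r + n * m)"
      by (simp add: N_def M_def R_def)
    then show False using no by (simp only: of_nat_le_iff)
  qed
qed

text \<open>
  The number \<open>(n - 1) t + n k + e\<close> is the order of the generator if \<open>x, y\<close> have order \<open>1\<close> and \<open>z\<close> has
  order \<open>n - 1\<close>; elements of the \<open>r\<close>-th power have order at least \<open>n r\<close>.
\<close>

lemma almost_collinear_arith_witness:
  fixes n m r :: nat
  assumes "n \<ge> 2" and yes: "n * n * m + m + n \<le> n * n * r + n * m"
  obtains t k e where "m \<le> t + k" "m \<le> n * k + e" "(n - 1) * t + n * k + e < n * r"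
proof (cases "r \<le> m")
  case False
  then have "n * m < n * r" using assms(1) by simp
  moreover have "1 * m \<le> n * m" using assms(1) by (intro mult_le_mono) auto
  ultimately show ?thesis by (intro that[of 0 m 0]) auto
next
  case True
  define N D R where "N = int n" and "D = int (m - r)" and "R = int r"
  have N: "N \<ge> 2" using assms(1) by (simp add: N_def)
  have m: "int m = R + D" using True by (simp add: R_def D_def)
  have "int (n * n * m + m + n) \<le> int (n * n * r + n * m)" using yes by (simp only: of_nat_le_iff)
  then have key: "N * N * D - N * D + D + N \<le> N * R - R"
    using m by (simp add: N_def R_def[symmetric] algebra_simps)
  have "(N - 1) * 1 < (N - 1) * (R - N * D)"
    using key N by (simp add: algebra_simps) (simp add: D_def)
  then have "1 < R - N * D" using N by (simp add: mult_less_cancel_left)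
  then have "int (n * (m - r) + 1) < int r" by (simp add: N_def D_def R_def)
  then have t_r: "n * (m - r) + 1 < r" by (simp only: of_nat_less_iff)
  \<comment> \<open>The least \<open>t\<close> for which \<open>F\<close> to the power \<open>m - t\<close> has order below \<open>n r - (n - 1) t\<close>.\<close>
  define t where "t = n * (m - r) + 1"
  define k where "k = m - t"
  have tm: "t < r" "t + k = m" using t_r True by (simp_all add: t_def k_def)
  have T: "int t = N * D + 1" by (simp add: t_def N_def D_def)
  have K: "int k = R + D - int t" using tm m by simp
  show ?thesis
  proof (rule that[of t k "m - n * k"])
    have "int ((n - 1) * t + n * k) = int (n - 1) * int t + N * int k"
      by (simp only: of_nat_add of_nat_mult N_def)
    also have "int (n - 1) = N - 1" using assms(1) by (simp add: N_def of_nat_diff)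
    finally have w: "int ((n - 1) * t + n * k) = N * R + N * D - int t"
      by (simp add: K algebra_simps)
    have "int ((n - 1) * t + n * k + (m - n * k)) < int (n * r)"
    proof (cases "m \<le> n * k")
      case True
      then show ?thesis using w T by (simp add: N_def R_def)
    next
      case False
      then have "int ((n - 1) * t + n * k + (m - n * k)) = (N - 1) * int t + R + D"
        using m assms(1) by (simp add: N_def of_nat_diff)
      also have "\<dots> = N * N * D - N * D + D + N - 1 + R" by (simp add: T algebra_simps)
      also have "\<dots> < N * R" using key by simp
      finally show ?thesis by (simp add: N_def R_def)
    qed
    then show "(n - 1) * t + n * k + (m - n * k) < n * r" by (simp only: of_nat_less_iff)
  qed (use tm in auto)
qed

lemma almost_collinear_containment_iff:
  fixes Q :: "'a::field proj_plane set"
  assumes ac: "almost_collinear n Q" and r: "r > 0"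
  shows "symbolic_power Q m \<subseteq> ideal_power (points_ideal Q) r \<longleftrightarrow>
    \<not> n * n * m + m + n \<le> n * n * r + n * m"
proof -
  have n: "n \<ge> 2" using ac by (simp add: almost_collinear_def)
  obtain x y z :: "'a ^ 3" and b c :: "nat \<Rightarrow> 'a" where
    fr: "frame z y x"
    and nz: "\<And>i. i \<in> {1..n} \<Longrightarrow> b i \<noteq> 0 \<or> c i \<noteq> 0"
    and indep: "\<And>i j. i \<in> {1..n} \<Longrightarrow> j \<in> {1..n} \<Longrightarrow> i \<noteq> j \<Longrightarrow> b i * c j \<noteq> b j * c i"
    and symb: "\<And>m. symbolic_power Q m = ideal_power (ideal_gen {lin x, lin y}) m \<inter>
       (\<Inter>i\<in>{1..n}. ideal_power (ideal_gen {lin z, Const (b i) * lin y + Const (c i) * lin x}) m)"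
    by (rule almost_collinear_coordinates[OF ac]) blast
  define l where "l i = Const (b i) * lin y + Const (c i) * lin x" for i
  define F where "F = (\<Prod>i\<in>{1..n}. l i)"
  define J where "J = points_ideal Q"
  have symb: "symbolic_power Q m = ideal_gen {lin z ^ t * F ^ k * (lin x ^ i * lin y ^ j) |
      t k i j. m \<le> t + k \<and> m \<le> n * k + i + j}" for m
    unfolding symb F_def l_def by (rule almost_collinear_symbolic_power[OF fr nz indep])
  have J: "J = ideal_gen {lin z ^ t * F ^ k * (lin x ^ i * lin y ^ j) |
      t k i j. 1 \<le> t + k \<and> 1 \<le> n * k + i + j}"
    unfolding J_def points_ideal_eq_symbolic_power symb ..
  have gen: "lin z ^ t * F ^ k * (lin x ^ i * lin y ^ j) \<in> J"
    if "1 \<le> t + k" "1 \<le> n * k + i + j" for t k i j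
    unfolding J by (rule ideal_gen_base) (use that in blast)
  let ?M = "ideal_gen {lin x, lin y}"
  have zM: "lin z * a \<in> J" if "a \<in> ?M" for a
    using that gen[of 1 0 1 0] gen[of 1 0 0 1] unfolding J by (intro ideal_gen_scaled[OF that]) auto
  have FJ: "F \<in> J" using gen[of 0 1 0 0] n by simp
  have FM: "F \<in> ideal_power ?M n"
    using prod_mem_ideal_power[of "{1..n}" l ?M]
    by (simp add: F_def l_def ideal_gen_add ideal_gen_mult ideal_gen_base)
  have monM: "F ^ k * (lin x ^ i * lin y ^ j) \<in> ideal_power ?M s" if "s \<le> n * k + i + j" for k i j s
  proof -
    have "F ^ k * (lin x ^ i * lin y ^ j) \<in> ideal_power ?M (n * k + (i + j))"
      by (intro ideal_power_mult_mem power_mem_ideal_power FM monomial_mem_ideal_power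
          ideal_gen_base) auto
    then show ?thesis using ideal_power_antimono[of s "n * k + (i + j)" ?M] that by auto
  qed
  show ?thesis
  proof
    assume no: "\<not> n * n * m + m + n \<le> n * n * r + n * m"
    note arith = almost_collinear_arith_contained[OF n r no]
    show "symbolic_power Q m \<subseteq> ideal_power (points_ideal Q) r"
      unfolding symb J_def[symmetric]
    proof (rule ideal_gen_subset_ideal_power, safe)
      fix t k i j assume m: "m \<le> t + k" "m \<le> n * k + i + j"
      show "lin z ^ t * F ^ k * (lin x ^ i * lin y ^ j) \<in> ideal_power J r"
      proof (cases "r \<le> t")
        case True
        have "F ^ k * (lin x ^ i * lin y ^ j) \<in> ideal_power ?M r"
          using m(2) arith(1) by (intro monM) simp
        then have "lin z ^ r * (F ^ k * (lin x ^ i * lin y ^ j)) \<in> ideal_power J r"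
          by (rule ideal_power_scaled[rotated]) (rule zM)
        then have "lin z ^ (t - r) * (lin z ^ r * (F ^ k * (lin x ^ i * lin y ^ j)))
            \<in> ideal_power J r"
          by (rule ideal_power_scale_mem)
        also have "lin z ^ (t - r) * (lin z ^ r * (F ^ k * (lin x ^ i * lin y ^ j)))
            = lin z ^ (t - r + r) * F ^ k * (lin x ^ i * lin y ^ j)"
          by (simp only: power_add mult.assoc)
        finally show ?thesis using True by simp
      next
        case False
        let ?k = "k - (r - t)"
        have "t \<le> n * ?k + (i + j)" using arith(2)[of t k "i + j"] m False by simp
        then have "F ^ ?k * (lin x ^ i * lin y ^ j) \<in> ideal_power ?M t" by (intro monM) simp
        then have "lin z ^ t * (F ^ ?k * (lin x ^ i * lin y ^ j)) \<in> ideal_power J t"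
          by (rule ideal_power_scaled[rotated]) (rule zM)
        from ideal_power_mult_mem[OF power_mem_ideal_power'[OF FJ, of "r - t"] this]
        have "F ^ (r - t) * (lin z ^ t * (F ^ ?k * (lin x ^ i * lin y ^ j))) \<in> ideal_power J r"
          using False by simp
        also have "F ^ (r - t) * (lin z ^ t * (F ^ ?k * (lin x ^ i * lin y ^ j)))
            = lin z ^ t * F ^ ((r - t) + ?k) * (lin x ^ i * lin y ^ j)"
          by (simp only: power_add mult_ac)
        also have "(r - t) + ?k = k" using m(1) arith(1) False by simp
        finally show ?thesis .
      qed
    qed
  next
    assume sub: "symbolic_power Q m \<subseteq> ideal_power (points_ideal Q) r"
    show "\<not> n * n * m + m + n \<le> n * n * r + n * m"
    proof
      assume "n * n * m + m + n \<le> n * n * r + n * m"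
      then obtain t k e where w: "m \<le> t + k" "m \<le> n * k + e" "(n - 1) * t + n * k + e < n * r"
        using almost_collinear_arith_witness[OF n] by blast
      \<comment> \<open>Sending \<open>x, y\<close> to \<open>T, u T\<close> with a second variable \<open>u\<close> keeps \<open>F\<close> from vanishing, also over
        a finite field.\<close>
      let ?T = "[:0, 1:] :: 'a poly poly"
      have h: "unital_hom (\<lambda>c::'a. [:[:c:]:])"
        by (intro unital_hom_compose[OF unital_hom_const] unital_hom_const)
      obtain \<theta> where \<theta>: "unital_hom \<theta>" "\<And>c. \<theta> (Const c) = [:[:c:]:]"
        "\<theta> (lin z) = ?T ^ (n - 1)" "\<theta> (lin y) = [:[:0, 1:]:] * ?T" "\<theta> (lin x) = ?T"
        using frame_hom_exists[OF fr h] by metis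
      interpret \<theta>: unital_hom \<theta> by (rule \<theta>)
      define g where "g = (\<Prod>i\<in>{1..n}. [:c i, b i:])"
      have g: "g \<noteq> 0" using nz by (auto simp: g_def)
      have \<theta>_F: "\<theta> F = ?T ^ n * [:g:]"
      proof -
        interpret k: unital_hom "\<lambda>c::'a poly. [:c:]" by (rule unital_hom_const)
        have "\<theta> (l i) = ?T * [:[:c i, b i:]:]" for i by (simp add: l_def \<theta>)
        then show ?thesis by (simp only: F_def g_def \<theta>.hom_prod prod.distrib k.hom_prod) simp
      qed
      have \<theta>_gen: "\<theta> (lin z ^ t * F ^ k * (lin x ^ i * lin y ^ j))
          = ?T ^ ((n - 1) * t + n * k + i + j) * [:g ^ k * [:0, 1:] ^ j:]" for t k i j
        by (simp only: \<theta>.hom_mult \<theta>.hom_power \<theta>_F \<theta> power_mult_distrib power_add power_mult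
            poly_const_pow mult_ac) (simp add: mult_ac flip: power_mult)
      have dvd: "?T ^ n dvd \<theta> f" if "f \<in> J" for f
        using _ that unfolding J
      proof (rule \<theta>.hom_dvd_ideal_gen, safe)
        fix t k i j assume le: "1 \<le> t + k" "1 \<le> n * k + i + j"
        have "n \<le> (n - 1) * t + n * k + i + j"
        proof (cases "k = 0")
          case True
          then have "(n - 1) * 1 \<le> (n - 1) * t" using le by (intro mult_le_mono) auto
          moreover have "1 \<le> i + j" using le True by simp
          ultimately show ?thesis by linarith
        qed (simp add: trans_le_add1 trans_le_add2)
        then show "?T ^ n dvd \<theta> (lin z ^ t * F ^ k * (lin x ^ i * lin y ^ j))"
          unfolding \<theta>_gen by (intro dvd_mult2 le_imp_power_dvd)
      qed
      have "lin z ^ t * F ^ k * (lin x ^ e * lin y ^ 0) \<in> symbolic_power Q m"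
        unfolding symb by (rule ideal_gen_base) (use w in fastforce)
      with sub have "lin z ^ t * F ^ k * (lin x ^ e * lin y ^ 0) \<in> ideal_power J r"
        by (auto simp: J_def)
      then have "(?T ^ n) ^ r dvd \<theta> (lin z ^ t * F ^ k * (lin x ^ e * lin y ^ 0))"
        by (rule \<theta>.hom_dvd_ideal_power[rotated]) (rule dvd)
      then have "?T ^ (n * r) dvd ?T ^ ((n - 1) * t + n * k + e) * [:g ^ k:]"
        unfolding \<theta>_gen by (simp add: power_mult)
      then have "coeff [:g ^ k:] 0 = 0" by (rule var_power_dvd_imp) (rule w(3))
      then show False using g by simp
    qed
  qed
qed

section \<open>Nearly complete intersections\<close>

subsection \<open>Expansions with respect to a monic polynomial\<close>

lemma monic_division:
  fixes h :: "'t::idom poly"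
  assumes h: "lead_coeff h = 1" and deg: "degree h > 0"
  obtains q r where "p = h * q + r" "degree r < degree h"
proof -
  obtain q r where qr: "pseudo_divmod p h = (q, r)" by (cases "pseudo_divmod p h")
  have "h \<noteq> 0" using deg by auto
  from pseudo_divmod[OF this qr] h deg show ?thesis
    by (intro that[of q r]) auto
qed

lemma monic_division_unique:
  fixes h :: "'t::idom poly"
  assumes "h * q + r = h * q' + r'" "degree r < degree h" "degree r' < degree h"
  shows "q = q'" "r = r'"
proof -
  have eq: "h * (q - q') = r' - r" using assms(1) by (simp add: algebra_simps)
  show "q = q'"
  proof (rule ccontr)
    assume "q \<noteq> q'"
    moreover have "h \<noteq> 0" using assms(2) by auto
    ultimately have "degree h \<le> degree (h * (q - q'))" by (simp add: degree_mult_eq)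
    also have "\<dots> < degree h" unfolding eq using assms(2,3) by (rule degree_diff_less[rotated])
    finally show False by simp
  qed
  then show "r = r'" using assms(1) by simp
qed

text \<open>
  Division by \<open>h\<close> turns membership in the \<open>m\<close>-th power of \<open>(a, h)\<close> into divisibility of the remainder by
  \<open>a\<^sup>m\<close> and membership of the quotient in the power of exponent \<open>m - 1\<close>, truncated at \<open>0\<close>.
\<close>

lemma divide_pair_power:
  fixes h :: "'t::idom poly"
  assumes h: "lead_coeff h = 1" "degree h > 0"
    and p: "p \<in> ideal_gen {[:a:] ^ i * h ^ k | i k. m \<le> i + k}"
  obtains q r where "p = h * q + smult (a ^ m) r" "degree r < degree h"
    "q \<in> ideal_gen {[:a:] ^ i * h ^ k | i k. m - 1 \<le> i + k}"
proof -
  let ?G = "ideal_gen {[:a:] ^ i * h ^ k | i k. m - 1 \<le> i + k}"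
  have "\<exists>g g'. p = [:a:] ^ m * g + h * g' \<and> g' \<in> ?G"
    using p
  proof (induction rule: ideal_gen_induct)
    case zero
    have "0 = [:a:] ^ m * 0 + h * 0" by simp
    then show ?case using ideal_gen_0 by blast
  next
    case (step u s p)
    from step.IH obtain g g' where g: "p = [:a:] ^ m * g + h * g'" "g' \<in> ?G" by blast
    from step(1) obtain i k where s: "s = [:a:] ^ i * h ^ k" "m \<le> i + k" by blast
    show ?case
    proof (cases k)
      case 0
      then have "s = [:a:] ^ m * [:a:] ^ (i - m)" using s by (simp flip: power_add)
      then have "u * s + p = [:a:] ^ m * (u * [:a:] ^ (i - m) + g) + h * g'"
        by (simp add: g algebra_simps)
      then show ?thesis using g(2) by blast
    next
      case (Suc k')
      have "[:a:] ^ i * h ^ k' \<in> ?G" using s(2) Suc by (intro pair_gen_base) simp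
      then have "u * ([:a:] ^ i * h ^ k') + g' \<in> ?G"
        using g(2) by (simp only: ideal_gen_add ideal_gen_mult)
      moreover have "u * s + p = [:a:] ^ m * g + h * (u * ([:a:] ^ i * h ^ k') + g')"
        by (simp add: s Suc g algebra_simps)
      ultimately show ?thesis by blast
    qed
  qed
  then obtain g g' where g: "p = [:a:] ^ m * g + h * g'" "g' \<in> ?G" by blast
  obtain q r where qr: "g = h * q + r" "degree r < degree h"
    using monic_division[OF h] by blast
  have "p = h * (q * ([:a:] ^ m * h ^ 0) + g') + smult (a ^ m) r"
    by (simp add: g qr poly_const_pow smult_add_right algebra_simps)
  moreover have "[:a:] ^ m * h ^ 0 \<in> ?G" by (rule pair_gen_base) simp
  then have "q * ([:a:] ^ m * h ^ 0) + g' \<in> ?G"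
    using g(2) by (simp only: ideal_gen_add ideal_gen_mult)
  ultimately show ?thesis using that qr(2) by blast
qed

text \<open>An ideal generated by constants is stable under division by \<open>h\<close>.\<close>

lemma divide_const_pair_power:
  fixes h :: "'t::idom poly"
  assumes h: "lead_coeff h = 1" "degree h > 0"
    and p: "p \<in> ideal_gen {[:a:] ^ i * [:b:] ^ j | i j. s \<le> i + j}"
  obtains q r where "p = h * q + r" "degree r < degree h"
    "q \<in> ideal_gen {[:a:] ^ i * [:b:] ^ j | i j. s \<le> i + j}"
    "r \<in> ideal_gen {[:a:] ^ i * [:b:] ^ j | i j. s \<le> i + j}"
proof -
  let ?G = "ideal_gen {[:a:] ^ i * [:b:] ^ j | i j. s \<le> i + j}"
  have "\<exists>q r. p = h * q + r \<and> degree r < degree h \<and> q \<in> ?G \<and> r \<in> ?G"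
    using p
  proof (induction rule: ideal_gen_induct)
    case zero
    show ?case
      by (rule exI[of _ 0], rule exI[of _ 0]) (simp add: h(2) ideal_gen_0)
  next
    case (step u e p)
    from step.IH obtain q r where qr: "p = h * q + r" "degree r < degree h" "q \<in> ?G" "r \<in> ?G"
      by blast
    from step(1) obtain i j where "e = [:a:] ^ i * [:b:] ^ j" by blast
    then obtain c where c: "e = [:c:]" by (simp add: poly_const_pow)
    have e: "e \<in> ?G" using step(1) by (rule ideal_gen_base)
    obtain q' r' where qr': "u = h * q' + r'" "degree r' < degree h"
      using monic_division[OF h] by blast
    have "u * e + p = h * (q' * e + q) + (r' * e + r)"
      by (simp add: qr qr' algebra_simps)
    moreover have "degree (r' * e + r) < degree h"
      using qr(2) qr'(2) degree_smult_le[of c r'] by (intro degree_add_less) (auto simp: c)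
    moreover have "q' * e + q \<in> ?G" "r' * e + r \<in> ?G"
      using e qr(3,4) by (simp_all only: ideal_gen_add ideal_gen_mult)
    ultimately show ?case by blast
  qed
  then show ?thesis using that by blast
qed

lemma monomials_with_bounds:
  fixes p :: "'a::field poly poly"
  assumes x: "[:[:0, 1:]:] ^ m dvd p" and y: "[:0, 1:] ^ m dvd p"
    and s: "p \<in> ideal_gen {[:[:0, 1:]:] ^ i * [:0, 1:] ^ j | i j. s \<le> i + j}"
  shows "p \<in> ideal_gen {[:[:0, 1:]:] ^ i * [:0, 1:] ^ j | i j. m \<le> i \<and> m \<le> j \<and> s \<le> i + j}"
    (is "_ \<in> ideal_gen ?G")
proof -
  have "{[:[:0, 1:]:] ^ i * [:0, 1:] ^ j | i j. s \<le> i + j}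
      \<subseteq> ({[:0, 1:] ^ i * [:[:0, 1:]:] ^ j | i j. s \<le> i + j} :: 'a poly poly set)"
  proof safe
    fix i j assume "s \<le> i + j"
    then show "\<exists>ia ja. [:[:0, 1:]:] ^ i * [:0, 1:] ^ j = [:0, 1:] ^ ia * [:[:0, 1:]:] ^ ja \<and> s \<le> ia + ja"
      by (intro exI[of _ j] exI[of _ i] conjI) (rule mult.commute, simp)
  qed
  from subsetD[OF ideal_gen_mono[OF this] s]
  have 1: "[:0, 1:] ^ (s - t) dvd coeff p t" for t
    unfolding mem_pair_power_poly_iff by blast
  have 2: "[:0, 1:] ^ m dvd coeff p t" for t
    using x by (simp add: poly_const_pow const_poly_dvd_iff)
  obtain p' where p': "p = [:0, 1:] ^ m * p'" using y by (elim dvdE)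
  have "p = monom 1 m * p'" by (simp add: p' monom_altdef)
  then have 3: "coeff p t = 0" if "t < m" for t
    using that by (simp add: coeff_monom_mult)
  have "monom (coeff p t) t \<in> ideal_gen ?G" for t
  proof (cases "t < m")
    case True
    then show ?thesis by (simp add: 3 ideal_gen_0)
  next
    case False
    let ?e = "max m (s - t)"
    have "[:0, 1:] ^ ?e dvd coeff p t" using 1[of t] 2[of t] by (simp add: max_def)
    then obtain c where c: "coeff p t = [:0, 1:] ^ ?e * c" by (elim dvdE)
    have "[:[:0, 1:]:] ^ ?e * [:0, 1:] ^ t \<in> ?G" using False by fastforce
    then have "[:c:] * ([:[:0, 1:]:] ^ ?e * [:0, 1:] ^ t) \<in> ideal_gen ?G"
      by (intro ideal_gen_mult ideal_gen_base)
    also have "[:c:] * ([:[:0, 1:]:] ^ ?e * [:0, 1:] ^ t) = monom (coeff p t) t"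
      by (simp add: c monom_altdef poly_const_pow mult.commute)
    finally show ?thesis .
  qed
  then have "(\<Sum>t\<le>degree p. monom (coeff p t) t) \<in> ideal_gen ?G" by (intro ideal_gen_sum)
  then show ?thesis by (simp only: poly_as_sum_of_monoms)
qed

text \<open>
  With \<open>h\<close> monic in the outer variable, every polynomial has a unique expansion in powers of \<open>h\<close>
  whose coefficients have smaller degree. Each of the three membership conditions passes to
  quotient and remainder, and for the remainder they bound the exponents of the two
  inner variables.
\<close>

lemma three_ideals_inter:
  fixes h :: "'a::field poly poly poly"
  assumes h: "lead_coeff h = 1" "degree h > 0"
  defines "X \<equiv> [:[:[:0, 1:]:]:]" and "Y \<equiv> [:[:0, 1:]:]"
  assumes "p \<in> ideal_gen {X ^ i * h ^ k | i k. m \<le> i + k}"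
    and "p \<in> ideal_gen {Y ^ j * h ^ k | j k. m \<le> j + k}"
    and "p \<in> ideal_gen {X ^ i * Y ^ j | i j. s \<le> i + j}"
  shows "p \<in> ideal_gen {X ^ i * Y ^ j * h ^ k | i j k. s \<le> i + j \<and> m \<le> i + k \<and> m \<le> j + k}"
  using assms(5-7)
proof (induction "degree p" arbitrary: p m rule: less_induct)
  case less
  let ?G = "\<lambda>m. {X ^ i * Y ^ j * h ^ k | i j k. s \<le> i + j \<and> m \<le> i + k \<and> m \<le> j + k}"
  obtain q r1 where 1: "p = h * q + smult ([:[:0, 1:]:] ^ m) r1" "degree r1 < degree h"
    "q \<in> ideal_gen {X ^ i * h ^ k | i k. m - 1 \<le> i + k}"
    using divide_pair_power[OF h less.prems(1)[unfolded X_def]] unfolding X_def by blast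
  obtain q2 r2 where 2: "p = h * q2 + smult ([:0, 1:] ^ m) r2" "degree r2 < degree h"
    "q2 \<in> ideal_gen {Y ^ j * h ^ k | j k. m - 1 \<le> j + k}"
    using divide_pair_power[OF h less.prems(2)[unfolded Y_def]] unfolding Y_def by blast
  obtain q3 r where 3: "p = h * q3 + r" "degree r < degree h"
    "q3 \<in> ideal_gen {X ^ i * Y ^ j | i j. s \<le> i + j}"
    "r \<in> ideal_gen {X ^ i * Y ^ j | i j. s \<le> i + j}"
    using divide_const_pair_power[OF h less.prems(3)[unfolded X_def Y_def]]
    unfolding X_def Y_def by blast
  have d: "degree (smult ([:[:0, 1:]:] ^ m) r1) < degree h" "degree (smult ([:0, 1:] ^ m) r2) < degree h"
    using 1(2) 2(2) degree_smult_le le_less_trans by blast+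
  have q: "q2 = q" "q3 = q" and r: "r = smult ([:[:0, 1:]:] ^ m) r1" "r = smult ([:0, 1:] ^ m) r2"
    using monic_division_unique[OF _ 3(2) d(1)] monic_division_unique[OF _ 3(2) d(2)] 1(1) 2(1) 3(1)
    by metis+
  have r_mem: "r \<in> ideal_gen (?G m)"
  proof -
    have "[:0, 1:] ^ t * [:coeff r t:] \<in> ideal_gen (?G m)" for t
    proof (rule ideal_gen_mult)
      have "[:[:0, 1:]:] ^ m dvd coeff r t" by (subst r(1)) simp
      moreover have "[:0, 1:] ^ m dvd coeff r t" by (subst r(2)) simp
      moreover have "coeff r t \<in> ideal_gen {[:[:0, 1:]:] ^ i * [:0, 1:] ^ j | i j. s \<le> i + j}"
        by (rule coeff_mem_ideal_gen) (use 3(4) in \<open>simp only: X_def Y_def\<close>)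
      ultimately have "coeff r t
          \<in> ideal_gen {[:[:0, 1:]:] ^ i * [:0, 1:] ^ j | i j. m \<le> i \<and> m \<le> j \<and> s \<le> i + j}"
        by (rule monomials_with_bounds)
      then have "[:coeff r t:] \<in> ideal_gen ((\<lambda>c. [:c:]) `
          {[:[:0, 1:]:] ^ i * [:0, 1:] ^ j | i j. m \<le> i \<and> m \<le> j \<and> s \<le> i + j})"
        by (rule unital_hom.hom_ideal_gen[OF unital_hom_const])
      also have "\<dots> \<subseteq> ideal_gen (?G m)"
      proof (rule ideal_gen_mono, safe)
        fix i j assume ij: "m \<le> i" "m \<le> j" "s \<le> i + j"
        have "[:[:[:0, 1:]:] ^ i * [:0, 1:] ^ j:] = X ^ i * Y ^ j * h ^ 0"
          by (simp add: X_def Y_def poly_const_pow mult.commute)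
        moreover have "s \<le> i + j \<and> m \<le> i + 0 \<and> m \<le> j + 0" using ij by simp
        ultimately show "\<exists>ia ja k. [:[:[:0, 1:]:] ^ i * [:0, 1:] ^ j:] = X ^ ia * Y ^ ja * h ^ k
            \<and> s \<le> ia + ja \<and> m \<le> ia + k \<and> m \<le> ja + k" by blast
      qed
      finally show "[:coeff r t:] \<in> ideal_gen (?G m)" .
    qed
    then have "(\<Sum>t\<le>degree r. [:0, 1:] ^ t * [:coeff r t:]) \<in> ideal_gen (?G m)"
      by (intro ideal_gen_sum)
    also have "(\<Sum>t\<le>degree r. [:0, 1:] ^ t * [:coeff r t:]) = (\<Sum>t\<le>degree r. monom (coeff r t) t)"
      by (simp add: monom_altdef)
    finally show ?thesis by (simp only: poly_as_sum_of_monoms)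
  qed
  have "h * q \<in> ideal_gen (?G m)"
  proof (cases "q = 0")
    case False
    have "h \<noteq> 0" using h(2) by auto
    then have deg: "degree (h * q) = degree h + degree q" using False by (simp add: degree_mult_eq)
    then have "degree p = degree h + degree q"
      using 3(1,2) unfolding q(2) by (simp add: degree_add_eq_left)
    then have "degree q < degree p" using h(2) by simp
    from less.hyps[OF this 1(3) 2(3)[unfolded q(1)] 3(3)[unfolded q(2)]]
    show ?thesis
    proof (rule ideal_gen_scaled)
      fix e assume "e \<in> ?G (m - 1)"
      then obtain i j k where e: "e = X ^ i * Y ^ j * h ^ k"
        "s \<le> i + j" "m - 1 \<le> i + k" "m - 1 \<le> j + k" by blast
      have "h * e = X ^ i * Y ^ j * h ^ Suc k" by (simp add: e mult_ac)
      moreover have "s \<le> i + j \<and> m \<le> i + Suc k \<and> m \<le> j + Suc k" using e(2-4) by arith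
      ultimately show "h * e \<in> ideal_gen (?G m)" by (intro ideal_gen_base) blast
    qed
  qed (simp add: ideal_gen_0)
  then show ?case using r_mem 3(1) unfolding q(2) by (simp only: ideal_gen_add)
qed

subsection \<open>Symbolic powers and containment\<close>

lemma prod_translates:
  fixes u w :: "'r::comm_ring_1"
  assumes "finite S"
  obtains g where "(\<Prod>i\<in>S. u - a i * w) = u ^ card S + w * g"
proof -
  have "\<exists>g. (\<Prod>i\<in>S. u - a i * w) = u ^ card S + w * g"
    using assms
  proof (induction S rule: finite_induct)
    case (insert i S)
    then obtain g where "(\<Prod>i\<in>S. u - a i * w) = u ^ card S + w * g" by blast
    then have "(\<Prod>i\<in>insert i S. u - a i * w)
        = u ^ card (insert i S) + w * (u * g - a i * u ^ card S - a i * w * g)"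
      using insert.hyps by (simp add: algebra_simps)
    then show ?case by blast
  qed (auto intro: exI[of _ 0])
  then show ?thesis using that by blast
qed

lemma ideal_gen_pair_cong:
  fixes a :: "'r::comm_ring_1"
  assumes "b' = b + a * g"
  shows "ideal_gen {a, b} = ideal_gen {a, b'}"
proof
  have "b' - g * a \<in> ideal_gen {a, b'}" "g * a + b \<in> ideal_gen {a, b}"
    by (simp_all add: ideal_gen_diff ideal_gen_add ideal_gen_mult ideal_gen_base)
  moreover have "b' - g * a = b" "g * a + b = b'" by (simp_all add: assms mult.commute)
  ultimately have "b \<in> ideal_gen {a, b'}" "b' \<in> ideal_gen {a, b}" by (simp_all only:)
  then have "{a, b} \<subseteq> ideal_gen {a, b'}" "{a, b'} \<subseteq> ideal_gen {a, b}"
    by (simp_all add: ideal_gen_base)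
  then show "ideal_gen {a, b} \<subseteq> ideal_gen {a, b'}" "ideal_gen {a, b'} \<subseteq> ideal_gen {a, b}"
    using ideal_gen_least by blast+
qed

text \<open>
  The product of the lines through the points of \<open>x = 0\<close> is a form \<open>F\<close> in \<open>y, z\<close>, the one for
  \<open>y = 0\<close> is a form \<open>G\<close> in \<open>x, z\<close>, and both have leading term \<open>z\<^sup>n\<close>. The form \<open>H = F + G - z\<^sup>n\<close>
  agrees with \<open>F\<close> modulo \<open>x\<close> and with \<open>G\<close> modulo \<open>y\<close>, so the \<open>2 n\<close> points are the complete
  intersection of \<open>x y = 0\<close> and \<open>H = 0\<close>, and the symbolic powers are monomial in \<open>x, y, H\<close>.
\<close>

lemma nearly_complete_intersection_symbolic_power:
  fixes x y z :: "'a::field ^ 3" and b c :: "nat \<Rightarrow> 'a"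
  assumes fr: "frame z y x" and n: "n > 0"
    and S: "finite S1" "card S1 = n" "finite S2" "card S2 = n"
    and inj: "inj_on b S1" "inj_on c S2"
  defines "F \<equiv> \<Prod>i\<in>S1. lin z - Const (b i) * lin y"
    and "G \<equiv> \<Prod>i\<in>S2. lin z - Const (c i) * lin x"
  defines "H \<equiv> F + G - lin z ^ n"
  shows "ideal_power (ideal_gen {lin x, lin y}) m \<inter>
      (\<Inter>i\<in>S1. ideal_power (ideal_gen {lin x, lin z - Const (b i) * lin y}) m) \<inter>
      (\<Inter>i\<in>S2. ideal_power (ideal_gen {lin y, lin z - Const (c i) * lin x}) m) =
    ideal_gen {lin x ^ i * lin y ^ j * H ^ k | i j k. m \<le> i + j \<and> m \<le> i + k \<and> m \<le> j + k}"
    (is "?S = ideal_gen ?G")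
proof
  interpret Co: unital_hom "Const :: 'a \<Rightarrow> _" by (rule unital_hom_Const)
  obtain f where f: "F = lin z ^ n + lin y * f"
    using prod_translates[OF S(1), of "lin z" "\<lambda>i. Const (b i)" "lin y"] S(2) unfolding F_def by blast
  obtain g where g: "G = lin z ^ n + lin x * g"
    using prod_translates[OF S(3), of "lin z" "\<lambda>i. Const (c i)" "lin x"] S(4) unfolding G_def by blast
  have H_F: "H = F + lin x * g" and H_G: "H = G + lin y * f"
    by (simp_all add: H_def f g)
  show "ideal_gen ?G \<subseteq> ?S"
  proof
    fix h assume h: "h \<in> ideal_gen ?G"
    have 1: "?G \<subseteq> ideal_power (ideal_gen {lin x, lin y}) m"
    proof safe
      fix i j k assume le: "m \<le> i + j" "m \<le> i + k" "m \<le> j + k"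
      have "lin x ^ i * lin y ^ j \<in> ideal_power (ideal_gen {lin x, lin y}) (i + j)"
        by (intro monomial_mem_ideal_power ideal_gen_base) auto
      then have "H ^ k * (lin x ^ i * lin y ^ j) \<in> ideal_power (ideal_gen {lin x, lin y}) (i + j)"
        by (rule ideal_power_scale_mem)
      then show "lin x ^ i * lin y ^ j * H ^ k \<in> ideal_power (ideal_gen {lin x, lin y}) m"
        using ideal_power_antimono[OF le(1)] by (auto simp: mult.commute)
    qed
    have 2: "?G \<subseteq> ideal_power (ideal_gen {lin x, lin z - Const (b q) * lin y}) m"
      (is "_ \<subseteq> ideal_power ?J m") if q: "q \<in> S1" for q
    proof safe
      fix i j k assume le: "m \<le> i + j" "m \<le> i + k" "m \<le> j + k"
      have "lin z - Const (b q) * lin y dvd F" unfolding F_def using q S by (intro dvd_prodI) auto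
      then obtain F' where F': "F = F' * (lin z - Const (b q) * lin y)" by (metis dvdE mult.commute)
      have "H = F' * (lin z - Const (b q) * lin y) + g * lin x" by (simp add: H_F F' mult.commute)
      then have "H \<in> ?J" by (simp add: ideal_gen_add ideal_gen_mult ideal_gen_base)
      then have "lin x ^ i * H ^ k \<in> ideal_power ?J (i + k)"
        by (rule monomial_mem_ideal_power[rotated]) (simp add: ideal_gen_base)
      then have "lin y ^ j * (lin x ^ i * H ^ k) \<in> ideal_power ?J (i + k)"
        by (rule ideal_power_scale_mem)
      then show "lin x ^ i * lin y ^ j * H ^ k \<in> ideal_power ?J m"
        using ideal_power_antimono[OF le(2)] by (auto simp: mult_ac)
    qed
    have 3: "?G \<subseteq> ideal_power (ideal_gen {lin y, lin z - Const (c q) * lin x}) m"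
      (is "_ \<subseteq> ideal_power ?J m") if q: "q \<in> S2" for q
    proof safe
      fix i j k assume le: "m \<le> i + j" "m \<le> i + k" "m \<le> j + k"
      have "lin z - Const (c q) * lin x dvd G" unfolding G_def using q S by (intro dvd_prodI) auto
      then obtain G' where G': "G = G' * (lin z - Const (c q) * lin x)" by (metis dvdE mult.commute)
      have "H = G' * (lin z - Const (c q) * lin x) + f * lin y" by (simp add: H_G G' mult.commute)
      then have "H \<in> ?J" by (simp add: ideal_gen_add ideal_gen_mult ideal_gen_base)
      then have "lin y ^ j * H ^ k \<in> ideal_power ?J (j + k)"
        by (rule monomial_mem_ideal_power[rotated]) (simp add: ideal_gen_base)
      then have "lin x ^ i * (lin y ^ j * H ^ k) \<in> ideal_power ?J (j + k)"
        by (rule ideal_power_scale_mem)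
      then show "lin x ^ i * lin y ^ j * H ^ k \<in> ideal_power ?J m"
        using ideal_power_antimono[OF le(3)] by (auto simp: mult_ac)
    qed
    show "h \<in> ?S"
      using subsetD[OF ideal_gen_subset_ideal_power[OF 1] h]
        subsetD[OF ideal_gen_subset_ideal_power[OF 2] h]
        subsetD[OF ideal_gen_subset_ideal_power[OF 3] h] by (intro IntI INT_I)
  qed
  show "?S \<subseteq> ideal_gen ?G"
  proof
    fix h assume h: "h \<in> ?S"
    have frs: "frame x z y" "frame y z x" using fr frame_swap12 frame_swap23 by metis+
    have "h \<in> ideal_gen {lin x ^ i * F ^ k | i k. m \<le> i + k}"
      unfolding F_def
    proof (rule inter_pair_powers[OF frs(1) S(1), where b = "\<lambda>_. 1" and c = "\<lambda>i. - b i"])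
      show "lin z - Const (b i) * lin y = Const 1 * lin z + Const (- b i) * lin y" for i
        unfolding Co.hom_minus Co.hom_1 by simp
      show "h \<in> ideal_gen {lin x ^ s * (lin z - Const (b i) * lin y) ^ t | s t. m \<le> s + t}"
        if "i \<in> S1" for i
        using h that by (auto simp flip: ideal_power_pair)
      show "1 * - b j \<noteq> 1 * - b i" if "i \<in> S1" "j \<in> S1" "i \<noteq> j" for i j
        using inj(1) that by (auto dest: inj_onD)
    qed simp
    then have "h \<in> ideal_power (ideal_gen {lin x, H}) m"
      unfolding ideal_gen_pair_cong[OF H_F, symmetric] ideal_power_pair .
    then have hX: "h \<in> ideal_gen {lin x ^ i * H ^ k | i k. m \<le> i + k}"
      unfolding ideal_power_pair .
    have "h \<in> ideal_gen {lin y ^ i * G ^ k | i k. m \<le> i + k}"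
      unfolding G_def
    proof (rule inter_pair_powers[OF frs(2) S(3), where b = "\<lambda>_. 1" and c = "\<lambda>i. - c i"])
      show "lin z - Const (c i) * lin x = Const 1 * lin z + Const (- c i) * lin x" for i
        unfolding Co.hom_minus Co.hom_1 by simp
      show "h \<in> ideal_gen {lin y ^ s * (lin z - Const (c i) * lin x) ^ t | s t. m \<le> s + t}"
        if "i \<in> S2" for i
        using h that by (auto simp flip: ideal_power_pair)
      show "1 * - c j \<noteq> 1 * - c i" if "i \<in> S2" "j \<in> S2" "i \<noteq> j" for i j
        using inj(2) that by (auto dest: inj_onD)
    qed simp
    then have "h \<in> ideal_power (ideal_gen {lin y, H}) m"
      unfolding ideal_gen_pair_cong[OF H_G, symmetric] ideal_power_pair .
    then have hY: "h \<in> ideal_gen {lin y ^ i * H ^ k | i k. m \<le> i + k}"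
      unfolding ideal_power_pair .
    have hXY: "h \<in> ideal_gen {lin x ^ i * lin y ^ j | i j. m \<le> i + j}"
      using h by (simp flip: ideal_power_pair)
    let ?C = "coord_hom (lin z) (lin y) (lin x)"
    interpret C: unital_hom ?C by (rule unital_hom_coord)
    obtain \<psi> where \<psi>: "unital_hom \<psi>" "\<And>f. ?C (\<psi> f) = f" "\<And>p. \<psi> (?C p) = p"
      using frame_iso[OF fr] by metis
    interpret \<psi>: unital_hom \<psi> by (rule \<psi>)
    have \<psi>_vars: "\<psi> (lin z) = [:0, 1:]" "\<psi> (lin y) = [:[:0, 1:]:]" "\<psi> (lin x) = [:[:[:0, 1:]:]:]"
      using \<psi>(3)[of "[:0, 1:]"] \<psi>(3)[of "[:[:0, 1:]:]"] \<psi>(3)[of "[:[:[:0, 1:]:]:]"]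
      by (simp_all only: coord_hom_vars)
    have \<psi>_Const: "\<psi> (Const a) = [:[:[:a:]:]:]" for a
      using \<psi>(3)[of "[:[:[:a:]:]:]"] by (simp only: coord_hom_const3)
    have monic: "degree (\<Prod>i\<in>S. [:e i, 1:]) = card S \<and> coeff (\<Prod>i\<in>S. [:e i, 1:]) (card S) = 1"
      if "finite S" for S :: "nat set" and e :: "nat \<Rightarrow> 'a poly poly"
    proof -
      have "degree (\<Prod>i\<in>S. [:e i, 1:]) = card S"
        by (subst degree_prod_eq_sum_degree) auto
      moreover have "lead_coeff (\<Prod>i\<in>S. [:e i, 1:]) = 1"
        by (simp add: lead_coeff_prod)
      ultimately show ?thesis by simp
    qed
    have \<psi>_F: "\<psi> F = (\<Prod>i\<in>S1. [:- [:0, [:b i:]:], 1:])"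
      unfolding F_def \<psi>.hom_prod \<psi>.hom_diff \<psi>.hom_mult \<psi>_vars \<psi>_Const by simp
    have \<psi>_G: "\<psi> G = (\<Prod>i\<in>S2. [:- [:[:0, c i:]:], 1:])"
      unfolding G_def \<psi>.hom_prod \<psi>.hom_diff \<psi>.hom_mult \<psi>_vars \<psi>_Const by simp
    have \<psi>_H: "\<psi> H = \<psi> F + \<psi> G - monom 1 n"
      by (simp add: H_def \<psi>_vars monom_altdef)
    have "coeff (\<psi> H) n = 1"
      unfolding \<psi>_H \<psi>_F \<psi>_G using monic[OF S(1)] monic[OF S(3)] by (simp add: S)
    moreover have "degree (\<psi> H) \<le> n"
      unfolding \<psi>_H \<psi>_F \<psi>_G using monic[OF S(1)] monic[OF S(3)]
      by (intro degree_diff_le degree_add_le) (simp_all add: S degree_monom_le)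
    ultimately have "degree (\<psi> H) = n" "lead_coeff (\<psi> H) = 1"
      using le_degree[of "\<psi> H" n] by auto
    then have "\<psi> h \<in> ideal_gen {[:[:[:0, 1:]:]:] ^ i * [:[:0, 1:]:] ^ j * \<psi> H ^ k | i j k.
        m \<le> i + j \<and> m \<le> i + k \<and> m \<le> j + k}"
      using \<psi>.hom_pair_power[OF hX] \<psi>.hom_pair_power[OF hY] \<psi>.hom_pair_power[OF hXY] n
      unfolding \<psi>_vars by (intro three_ideals_inter) simp_all
    from C.hom_ideal_gen[OF this] have "h \<in> ideal_gen (?C `
        {[:[:[:0, 1:]:]:] ^ i * [:[:0, 1:]:] ^ j * \<psi> H ^ k | i j k.
          m \<le> i + j \<and> m \<le> i + k \<and> m \<le> j + k})"
      by (simp only: \<psi>)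
    also have "\<dots> \<subseteq> ideal_gen ?G"
    proof (rule ideal_gen_mono, rule image_subsetI)
      fix e assume "e \<in> {[:[:[:0, 1:]:]:] ^ i * [:[:0, 1:]:] ^ j * \<psi> H ^ k | i j k.
          m \<le> i + j \<and> m \<le> i + k \<and> m \<le> j + k}"
      then obtain i j k where e: "e = [:[:[:0, 1:]:]:] ^ i * [:[:0, 1:]:] ^ j * \<psi> H ^ k"
        and le: "m \<le> i + j \<and> m \<le> i + k \<and> m \<le> j + k" by blast
      have "?C e = lin x ^ i * lin y ^ j * H ^ k"
        by (simp only: e C.hom_mult C.hom_power coord_hom_vars \<psi>)
      then show "?C e \<in> ?G" using le by blast
    qed
    finally show "h \<in> ideal_gen ?G" .
  qed
qed

lemma nearly_complete_intersection_containment_iff: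
  fixes Q :: "'a::field proj_plane set"
  assumes nci: "nearly_complete_intersection n Q"
  shows "symbolic_power Q m \<subseteq> ideal_power (points_ideal Q) r \<longleftrightarrow> 4 * r \<le> 3 * m + 1"
proof -
  have n: "n > 0" using nci by (simp add: nearly_complete_intersection_def)
  obtain x y z :: "'a ^ 3" and b c :: "nat \<Rightarrow> 'a" where
    fr: "frame z y x" and inj: "inj_on b {1..n}" "inj_on c {n+1..2*n}"
    and symb: "\<And>m. symbolic_power Q m = ideal_power (ideal_gen {lin x, lin y}) m \<inter>
       (\<Inter>i\<in>{1..n}. ideal_power (ideal_gen {lin x, lin z - Const (b i) * lin y}) m) \<inter>
       (\<Inter>i\<in>{n+1..2*n}. ideal_power (ideal_gen {lin y, lin z - Const (c i) * lin x}) m)"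
    by (rule nearly_complete_intersection_coordinates[OF nci]) blast
  define F where "F = (\<Prod>i\<in>{1..n}. lin z - Const (b i) * lin y)"
  define G where "G = (\<Prod>i\<in>{n+1..2*n}. lin z - Const (c i) * lin x)"
  define H where "H = F + G - lin z ^ n"
  define J where "J = points_ideal Q"
  have symb: "symbolic_power Q m = ideal_gen {lin x ^ i * lin y ^ j * H ^ k |
      i j k. m \<le> i + j \<and> m \<le> i + k \<and> m \<le> j + k}" for m
    unfolding symb H_def F_def G_def
    by (rule nearly_complete_intersection_symbolic_power[OF fr n _ _ _ _ inj]) auto
  have J: "J = ideal_gen {lin x ^ i * lin y ^ j * H ^ k |
      i j k. 1 \<le> i + j \<and> 1 \<le> i + k \<and> 1 \<le> j + k}"
    unfolding J_def points_ideal_eq_symbolic_power symb ..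
  have gen: "lin x ^ i * lin y ^ j * H ^ k \<in> J"
    if "1 \<le> i + j" "1 \<le> i + k" "1 \<le> j + k" for i j k
    unfolding J by (rule ideal_gen_base) (use that in blast)
  have J_mem: "lin x * lin y \<in> J" "lin x * H \<in> J" "lin y * H \<in> J"
    using gen[of 1 1 0] gen[of 1 0 1] gen[of 0 1 1] by simp_all
  show ?thesis
  proof
    assume le: "4 * r \<le> 3 * m + 1"
    show "symbolic_power Q m \<subseteq> ideal_power (points_ideal Q) r"
      unfolding symb J_def[symmetric]
    proof (rule ideal_gen_subset_ideal_power, safe)
      fix i j k assume m: "m \<le> i + j" "m \<le> i + k" "m \<le> j + k"
      \<comment> \<open>Split off \<open>e\<close> factors \<open>x y\<close>, \<open>d\<close> factors \<open>x H\<close> and \<open>q\<close> factors \<open>y H\<close>. Of the \<open>r\<close>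
        factors at most \<open>i\<close> can contain \<open>x\<close> and at most \<open>j\<close> can contain \<open>y\<close>, which forces
        \<open>q \<ge> r - i\<close> and \<open>d \<ge> r - j\<close>; the least such values will do.\<close>
      define q d e where "q = r - i" and "d = r - j" and "e = r - d - q"
      have deq: "d + q + e = r" "e + d \<le> i" "e + q \<le> j" "d + q \<le> k"
        using m le by (auto simp: q_def d_def e_def)
      have "(lin x * lin y) ^ e * ((lin x * H) ^ d * (lin y * H) ^ q) \<in> ideal_power J (e + (d + q))"
        by (intro ideal_power_mult_mem power_mem_ideal_power' J_mem)
      then have "(lin x ^ (i - (e + d)) * lin y ^ (j - (e + q)) * H ^ (k - (d + q))) *
          ((lin x * lin y) ^ e * ((lin x * H) ^ d * (lin y * H) ^ q)) \<in> ideal_power J (e + (d + q))"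
        by (rule ideal_power_scale_mem)
      also have "(lin x ^ (i - (e + d)) * lin y ^ (j - (e + q)) * H ^ (k - (d + q))) *
          ((lin x * lin y) ^ e * ((lin x * H) ^ d * (lin y * H) ^ q))
          = lin x ^ (i - (e + d) + (e + d)) * lin y ^ (j - (e + q) + (e + q)) *
            H ^ (k - (d + q) + (d + q))"
        by (simp only: power_add power_mult_distrib mult_ac)
      finally show "lin x ^ i * lin y ^ j * H ^ k \<in> ideal_power J r"
        using deq by (simp add: add.commute)
    qed
  next
    assume sub: "symbolic_power Q m \<subseteq> ideal_power (points_ideal Q) r"
    show "4 * r \<le> 3 * m + 1"
    proof (rule ccontr)
      assume "\<not> 4 * r \<le> 3 * m + 1"
      \<comment> \<open>The generator \<open>x\<^sup>i y\<^sup>i H\<^sup>k\<close> of least total degree in \<open>x, y, H\<close>.\<close>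
      define k where "k = m div 2"
      define i where "i = m - k"
      have w: "m \<le> i + i" "m \<le> i + k" "i + i + k < 2 * r"
        using \<open>\<not> 4 * r \<le> 3 * m + 1\<close> by (auto simp: i_def k_def)
      let ?T = "[:0, 1:] :: 'a poly poly"
      let ?u = "[:[:0, 1:]:] :: 'a poly poly"
      have h: "unital_hom (\<lambda>c::'a. [:[:c:]:])"
        by (intro unital_hom_compose[OF unital_hom_const] unital_hom_const)
      \<comment> \<open>The factor \<open>u\<close> is needed for \<open>n = 1\<close> only: then all terms of the image of \<open>H\<close> have the
        same order in \<open>T\<close>, and \<open>u\<close> keeps them from cancelling.\<close>
      obtain \<theta> where \<theta>: "unital_hom \<theta>" "\<And>c. \<theta> (Const c) = [:[:c:]:]"
        "\<theta> (lin z) = ?T" "\<theta> (lin y) = ?u * ?T ^ n" "\<theta> (lin x) = ?u * ?T ^ n"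
        using frame_hom_exists[OF fr h] by metis
      interpret \<theta>: unital_hom \<theta> by (rule \<theta>)
      define A where "A a = 1 - [:[:a:]:] * ?u * ?T ^ (n - 1)" for a
      have lin_A: "?T - [:[:a:]:] * (?u * ?T ^ n) = ?T * A a" for a
        using n by (cases n) (simp_all add: A_def algebra_simps)
      define g where "g = (\<Prod>i\<in>{1..n}. A (b i)) + (\<Prod>i\<in>{n+1..2*n}. A (c i)) - 1"
      have \<theta>_H: "\<theta> H = ?T ^ n * g"
      proof -
        have "\<theta> F = ?T ^ n * (\<Prod>i\<in>{1..n}. A (b i))" "\<theta> G = ?T ^ n * (\<Prod>i\<in>{n+1..2*n}. A (c i))"
          unfolding F_def G_def \<theta>.hom_prod \<theta>.hom_diff \<theta>.hom_mult \<theta> lin_A prod.distrib by simp_all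
        then show ?thesis unfolding H_def g_def by (simp add: \<theta> algebra_simps)
      qed
      have "poly (poly g 0) 0 = 1"
        by (simp add: g_def A_def poly_prod)
      then have g0: "poly g 0 \<noteq> 0" by auto
      have \<theta>_gen: "\<theta> (lin x ^ i * lin y ^ j * H ^ k)
          = ?T ^ (n * (i + j + k)) * (?u ^ (i + j) * g ^ k)" for i j k
        unfolding \<theta>.hom_mult \<theta>.hom_power \<theta>_H \<theta>
        by (simp only: power_mult_distrib power_add power_mult[symmetric] distrib_left mult_ac)
      have dvd: "?T ^ (2 * n) dvd \<theta> f" if "f \<in> J" for f
        using _ that unfolding J
      proof (rule \<theta>.hom_dvd_ideal_gen, safe)
        fix i j k :: nat assume "1 \<le> i + j" "1 \<le> i + k" "1 \<le> j + k"
        then have "n * 2 \<le> n * (i + j + k)" by (intro mult_le_mono) auto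
        then show "?T ^ (2 * n) dvd \<theta> (lin x ^ i * lin y ^ j * H ^ k)"
          unfolding \<theta>_gen by (intro dvd_mult2 le_imp_power_dvd) (simp add: mult.commute)
      qed
      have "lin x ^ i * lin y ^ i * H ^ k \<in> symbolic_power Q m"
        unfolding symb by (rule ideal_gen_base) (use w in blast)
      with sub have "lin x ^ i * lin y ^ i * H ^ k \<in> ideal_power J r"
        by (auto simp: J_def)
      then have "(?T ^ (2 * n)) ^ r dvd \<theta> (lin x ^ i * lin y ^ i * H ^ k)"
        by (rule \<theta>.hom_dvd_ideal_power[rotated]) (rule dvd)
      then have "?T ^ (n * (2 * r)) dvd ?T ^ (n * (i + i + k)) * (?u ^ (i + i) * g ^ k)"
        unfolding \<theta>_gen by (simp only: power_mult[symmetric] mult_ac)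
      then have "coeff (?u ^ (i + i) * g ^ k) 0 = 0"
        by (rule var_power_dvd_imp) (use w(3) n in simp)
      then have "poly (?u ^ (i + i) * g ^ k) 0 = 0" by (simp only: poly_0_coeff_0)
      then show False using g0 by simp
    qed
  qed
qed

section \<open>Resurgence\<close>

lemma resurgence_eqI:
  assumes N: "N > 0" and B: "B \<le> A"
    and iff: "\<And>m r. m > 0 \<Longrightarrow> r > 0 \<Longrightarrow>
      \<not> symbolic_power Q m \<subseteq> ideal_power (points_ideal Q) r \<longleftrightarrow> N * m + B \<le> A * r"
    and A: "A > 0"
  shows "resurgence Q = ereal (real A / real N)"
proof (rule antisym)
  have frac_le: "real m / real r \<le> real A / real N" if "r > 0" "N * m + B \<le> A * r" for m r
  proof -
    have "real (N * m) \<le> real (A * r)" using that(2) by (simp only: of_nat_le_iff)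
    then show ?thesis using that(1) N by (simp add: field_simps)
  qed
  show "resurgence Q \<le> ereal (real A / real N)"
    unfolding resurgence_def
  proof (rule Sup_least)
    fix e assume "e \<in> {ereal (real m / real r) | m r.
        m > 0 \<and> r > 0 \<and> \<not> symbolic_power Q m \<subseteq> ideal_power (points_ideal Q) r}"
    then obtain m r where "e = ereal (real m / real r)" "m > 0" "r > 0"
      "\<not> symbolic_power Q m \<subseteq> ideal_power (points_ideal Q) r" by blast
    then show "e \<le> ereal (real A / real N)" using frac_le[of r m] iff by simp
  qed
  \<comment> \<open>The pairs \<open>m = A k\<close>, \<open>r = N k + 1\<close> satisfy the inequality, and their ratios tend to \<open>A / N\<close>.\<close>
  have le: "ereal (real (A * k) / real (N * k + 1)) \<le> resurgence Q" if "k > 0" for k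
    unfolding resurgence_def
  proof (rule Sup_upper)
    have "\<not> symbolic_power Q (A * k) \<subseteq> ideal_power (points_ideal Q) (N * k + 1)"
      using iff[of "A * k" "N * k + 1"] that A B by (simp add: algebra_simps)
    then show "ereal (real (A * k) / real (N * k + 1)) \<in> {ereal (real m / real r) | m r.
        m > 0 \<and> r > 0 \<and> \<not> symbolic_power Q m \<subseteq> ideal_power (points_ideal Q) r}"
      using that A by (intro CollectI exI[of _ "A * k"] exI[of _ "N * k + 1"]) auto
  qed
  show "ereal (real A / real N) \<le> resurgence Q"
  proof (cases "resurgence Q")
    case (real s)
    have bound: "real k * (real A - s * real N) \<le> s" if "k > 0" for k
    proof -
      have "real (A * k) / real (N * k + 1) \<le> s" using le[OF that] real by simp
      moreover have "real (N * k + 1) > 0" by (simp only: of_nat_0_less_iff)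
      ultimately have "real (A * k) \<le> s * real (N * k + 1)" by (simp only: pos_divide_le_eq)
      then show ?thesis by (simp add: algebra_simps)
    qed
    have "real A - s * real N \<le> 0"
    proof (rule ccontr)
      assume "\<not> real A - s * real N \<le> 0"
      then obtain k where k: "s < real k * (real A - s * real N)"
        using reals_Archimedean3[of "real A - s * real N"] by force
      then have "real k * (real A - s * real N) \<le> real (Suc k) * (real A - s * real N)"
        using \<open>\<not> real A - s * real N \<le> 0\<close> by (intro mult_right_mono) auto
      then show False using k bound[of "Suc k"] by simp
    qed
    then show ?thesis using real N by (simp add: field_simps)
  next
    case MInf
    then show ?thesis using le[of 1] by simp
  qed simp
qed

theorem theorem1p5:
  fixes Q :: "'a::field proj_plane set"
  assumes "finite Q"
  shows "(\<forall>n. n \<ge> 3 \<and> almost_collinear n Q \<longrightarrow>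
            resurgence Q = ereal ((real n)\<^sup>2 / ((real n)\<^sup>2 - real n + 1)) \<and>
            (\<forall>m r. m > 0 \<and> r > 0 \<longrightarrow>
               (\<not> symbolic_power Q m \<subseteq> ideal_power (points_ideal Q) r \<longleftrightarrow>
                real m \<le> ((real n)\<^sup>2 * real r - real n) / ((real n)\<^sup>2 - real n + 1)))) \<and>
         (\<forall>n. nearly_complete_intersection n Q \<longrightarrow>
            resurgence Q = ereal (4 / 3) \<and>
            (\<forall>m r. m > 0 \<and> r > 0 \<longrightarrow>
               (symbolic_power Q m \<subseteq> ideal_power (points_ideal Q) r \<longleftrightarrow>
                4 * r \<le> 3 * m + 1)))"
proof (intro conjI allI impI; (elim conjE)?)
  fix n :: nat assume n: "n \<ge> 3" and ac: "almost_collinear n Q"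
  define N where "N = n * n - n + 1"
  have nn: "n \<le> n * n" by simp
  have real_N: "real N = (real n)\<^sup>2 - real n + 1"
    using nn by (simp add: N_def of_nat_diff power2_eq_square)
  have N_m: "N * m + n * m = n * n * m + m" for m
  proof -
    have "N + n = n * n + 1" using nn by (simp add: N_def)
    then have "(N + n) * m = (n * n + 1) * m" by (simp only:)
    then show ?thesis by (simp add: algebra_simps)
  qed
  have iff: "\<not> symbolic_power Q m \<subseteq> ideal_power (points_ideal Q) r \<longleftrightarrow> N * m + n \<le> n * n * r"
    if "r > 0" for m r
    unfolding almost_collinear_containment_iff[OF ac that] using N_m[of m] by linarith
  have "resurgence Q = ereal (real (n * n) / real N)"
    by (rule resurgence_eqI[OF _ nn iff]) (use n in \<open>simp_all add: N_def\<close>)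
  then show "resurgence Q = ereal ((real n)\<^sup>2 / ((real n)\<^sup>2 - real n + 1))"
    by (simp add: real_N power2_eq_square)
  fix m r :: nat assume "m > 0" "r > 0"
  have "N * m + n \<le> n * n * r \<longleftrightarrow> real (N * m + n) \<le> real (n * n * r)" by (simp only: of_nat_le_iff)
  also have "\<dots> \<longleftrightarrow> real m * real N \<le> (real n)\<^sup>2 * real r - real n"
    by (auto simp: power2_eq_square algebra_simps)
  also have "\<dots> \<longleftrightarrow> real m \<le> ((real n)\<^sup>2 * real r - real n) / real N"
    by (rule pos_le_divide_eq[symmetric]) (simp only: of_nat_0_less_iff, simp add: N_def)
  finally show "\<not> symbolic_power Q m \<subseteq> ideal_power (points_ideal Q) r \<longleftrightarrow>
      real m \<le> ((real n)\<^sup>2 * real r - real n) / ((real n)\<^sup>2 - real n + 1)"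
    using iff[OF \<open>r > 0\<close>] by (simp only: real_N)
next
  fix n assume nci: "nearly_complete_intersection n Q"
  note iff = nearly_complete_intersection_containment_iff[OF nci]
  have "resurgence Q = ereal (real 4 / real 3)"
    by (rule resurgence_eqI[of 3 2 4]) (auto simp: iff)
  then show "resurgence Q = ereal (4 / 3)" by simp
  show "symbolic_power Q m \<subseteq> ideal_power (points_ideal Q) r \<longleftrightarrow> 4 * r \<le> 3 * m + 1" for m r
    by (rule iff)
qed

end
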